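(* Let $\Omega\subseteq\mathbb{R}^N$ ($N\ge 2$) be a bounded domain, let $\mathcal{L}=\sum_{i,j=1}^N\partial_i(b_{ij}(x)\partial_j)$ be uniformly $X$-elliptic in $\Omega$ with respect to a family $X=\{X_1,\dots,X_m\}$ of vector fields, and assume the Sobolev-type embedding property (S). Let $a\in L^1(\Omega)$ with $a\ge0$ and let $f\in L^1(\Omega)$. Assume that there exist $Q\in(0,+\infty)$ and a function $0\le R\in L^{\frac{2N_X}{N_X+2}}(\Omega)$ such that $|f(x)|\le Q\,a(x)+R(x)$ for a.e. $x\in\Omega$. Then the problem $$-\mathcal{L}u+a(x)u=f(x)\ \text{ in }\Omega,\qquad u=0\ \text{ on }\partial\Omega$$ admits a unique weak solution $u\in\mathscr{H}_X(\Omega)$.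
   Context: **Vector fields and operator.** $X=\{X_1,\dots,X_m\}$ is a family of vector fields $X_j=(c_{j1},\dots,c_{jN})$ on $\mathbb{R}^N$ with $c_{jk}$ locally Lipschitz continuous on $\mathbb{R}^N$; $X_j$ is identified with the operator $X_j=\sum_{k=1}^N c_{jk}\partial_k$, and $Xu=(X_1u,\dots,X_mu)$ is the $X$-gradient. The coefficients $b_{ij}=b_{ji}$ are measurable functions on $\mathbb{R}^N$, and $B(x)=(b_{ij}(x))$. The operator $\mathcal{L}$ is uniformly $X$-elliptic in $\Omega$ if there is a constant $\Lambda>0$ such that $$\frac1\Lambda\sum_{j=1}^m\langle X_j(x),\xi\rangle^2\le\sum_{i,j=1}^N b_{ij}(x)\xi_i\xi_j\le\Lambda\sum_{j=1}^m\langle X_j(x),\xi\rangle^2\qquad\text{for all }\xi\in\mathbb{R}^N,\ x\in\Omega,$$ where $\langle X_j(x),\xi\rangle=\sum_{k=1}^N c_{jk}(x)\xi_k$. **Function space.** $u\mapsto\|u\|_X:=\|Xu\|_{L^2(\Omega)}$ is a norm on $C^1_0(\Omega)$, and $\mathscr{H}_X(\Omega)$ is the Hilbert space obtained as the completion of $C^1_0(\Omega)$ with respect to this norm, with scalar product $\langle u,v\rangle_X=\int_\Omega Xu\cdot Xv$. **Assumption (S).** There exists a number $2^*_X=2^*_X(\Omega)>2$ such that the embedding $\mathscr{H}_X(\Omega)\hookrightarrow L^p(\Omega)$ is continuous for $p\in[1,2^*_X]$ and compact for every $p\in[1,2^*_X)$. Elements of $\mathscr{H}_X(\Omega)$ are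 accordingly regarded as functions on $\Omega$. Set $N_X:=\frac{2\cdot 2^*_X}{2^*_X-2}$, so that $2^*_X=\frac{2N_X}{N_X-2}$. **Bilinear form.** By $X$-ellipticity, $\left|\int_\Omega B(x)\nabla u\cdot\nabla v\right|\le\Lambda\|u\|_X\|v\|_X$ for $u,v\in C^1_0(\Omega)$, so $(u,v)\mapsto\int_\Omega B(x)\nabla u\cdot\nabla v$ extends continuously to $\mathscr{H}_X(\Omega)\times\mathscr{H}_X(\Omega)$; the same notation is used for the extension. **Weak solution.** $u\in\mathscr{H}_X(\Omega)$ is a weak solution of the problem if $a\,u\in L^1(\Omega)$ and $$\int_\Omega B(x)\nabla u\cdot\nabla v+\int_\Omega a(x)uv=\int_\Omega f(x)v\qquad\text{for all }v\in\mathscr{H}_X(\Omega)\cap L^\infty(\Omega).$$ *)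

theory Defs
  imports "HOL-Analysis.Analysis"
begin

section \<open>Lebesgue spaces\<close>

text \<open>Elements are functions rather than classes; every notion below is invariant under
  changes on null sets.\<close>

definition Lp_space :: "'a measure \<Rightarrow> real \<Rightarrow> ('a \<Rightarrow> real) set" where
  "Lp_space M p = {u. u \<in> borel_measurable M \<and> integrable M (\<lambda>x. \<bar>u x\<bar> powr p)}"

definition Lp_norm :: "'a measure \<Rightarrow> real \<Rightarrow> ('a \<Rightarrow> real) \<Rightarrow> real" where
  "Lp_norm M p u = (\<integral>x. \<bar>u x\<bar> powr p \<partial>M) powr (1 / p)"

definition Linf_space :: "'a measure \<Rightarrow> ('a \<Rightarrow> real) set" where
  "Linf_space M = {u. u \<in> borel_measurable M \<and> (\<exists>C. AE x in M. \<bar>u x\<bar> \<le> C)}"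

section \<open>Vector fields and X-ellipticity\<close>

text \<open>\<open>X j x $ k\<close> is the coefficient \<open>c\<^sub>j\<^sub>k(x)\<close>, and \<open>B x $ i $ j\<close> is \<open>b\<^sub>i\<^sub>j(x)\<close>.\<close>

definition locally_lipschitz_fields :: "('m::finite \<Rightarrow> real^'n::finite \<Rightarrow> real^'n) \<Rightarrow> bool" where
  "locally_lipschitz_fields X \<longleftrightarrow>
     (\<forall>j k x. \<exists>e>0. \<exists>L. L-lipschitz_on (cball x e) (\<lambda>y. X j y $ k))"

definition uniformly_X_elliptic ::
  "(real^'n::finite) set \<Rightarrow> ('m::finite \<Rightarrow> real^'n \<Rightarrow> real^'n) \<Rightarrow> (real^'n \<Rightarrow> real^'n^'n) \<Rightarrow> bool" where
  "uniformly_X_elliptic \<Omega> X B \<longleftrightarrow>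
     (\<exists>\<Lambda>>0. \<forall>x\<in>\<Omega>. \<forall>\<xi>.
        (1 / \<Lambda>) * (\<Sum>j\<in>UNIV. (X j x \<bullet> \<xi>)\<^sup>2) \<le> (\<Sum>i\<in>UNIV. \<Sum>j\<in>UNIV. B x $ i $ j * \<xi> $ i * \<xi> $ j) \<and>
        (\<Sum>i\<in>UNIV. \<Sum>j\<in>UNIV. B x $ i $ j * \<xi> $ i * \<xi> $ j) \<le> \<Lambda> * (\<Sum>j\<in>UNIV. (X j x \<bullet> \<xi>)\<^sup>2))"

definition grad :: "(real^'n::finite \<Rightarrow> real) \<Rightarrow> real^'n \<Rightarrow> real^'n" where
  "grad u x = (\<chi> k. frechet_derivative u (at x) (axis k 1))"

definition X_deriv :: "(real^'n::finite \<Rightarrow> real^'n) \<Rightarrow> (real^'n \<Rightarrow> real) \<Rightarrow> real^'n \<Rightarrow> real" where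
  "X_deriv Y u x = (\<Sum>k\<in>UNIV. Y x $ k * grad u x $ k)"

text \<open>Continuously differentiable functions with compact support in \<open>\<Omega>\<close>, extended by zero.\<close>

definition C1_0 :: "(real^'n::finite) set \<Rightarrow> (real^'n \<Rightarrow> real) set" where
  "C1_0 \<Omega> = {u. (\<forall>x. u differentiable (at x)) \<and> continuous_on UNIV (grad u) \<and>
                compact (closure {x. u x \<noteq> 0}) \<and> closure {x. u x \<noteq> 0} \<subseteq> \<Omega>}"

definition X_norm ::
  "(real^'n::finite) set \<Rightarrow> ('m::finite \<Rightarrow> real^'n \<Rightarrow> real^'n) \<Rightarrow> (real^'n \<Rightarrow> real) \<Rightarrow> real" where
  "X_norm \<Omega> X u = sqrt (\<integral>x. (\<Sum>j\<in>UNIV. (X_deriv (X j) u x)\<^sup>2) \<partial>lebesgue_on \<Omega>)"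

section \<open>The completion of \<open>C1_0 \<Omega>\<close> for the X-norm\<close>

definition X_Cauchy ::
  "(real^'n::finite) set \<Rightarrow> ('m::finite \<Rightarrow> real^'n \<Rightarrow> real^'n) \<Rightarrow> (nat \<Rightarrow> real^'n \<Rightarrow> real) set" where
  "X_Cauchy \<Omega> X = {\<phi>. (\<forall>n. \<phi> n \<in> C1_0 \<Omega>) \<and>
     (\<forall>e>0. \<exists>M. \<forall>m\<ge>M. \<forall>n\<ge>M. X_norm \<Omega> X (\<lambda>x. \<phi> m x - \<phi> n x) < e)}"

definition X_equiv ::
  "(real^'n::finite) set \<Rightarrow> ('m::finite \<Rightarrow> real^'n \<Rightarrow> real^'n) \<Rightarrow> (nat \<Rightarrow> real^'n \<Rightarrow> real) rel" where
  "X_equiv \<Omega> X = {(\<phi>, \<psi>). \<phi> \<in> X_Cauchy \<Omega> X \<and> \<psi> \<in> X_Cauchy \<Omega> X \<and>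
     (\<lambda>n. X_norm \<Omega> X (\<lambda>x. \<phi> n x - \<psi> n x)) \<longlonglongrightarrow> 0}"

definition HX ::
  "(real^'n::finite) set \<Rightarrow> ('m::finite \<Rightarrow> real^'n \<Rightarrow> real^'n) \<Rightarrow> (nat \<Rightarrow> real^'n \<Rightarrow> real) set set" where
  "HX \<Omega> X = X_Cauchy \<Omega> X // X_equiv \<Omega> X"

definition HX_norm ::
  "(real^'n::finite) set \<Rightarrow> ('m::finite \<Rightarrow> real^'n \<Rightarrow> real^'n) \<Rightarrow> (nat \<Rightarrow> real^'n \<Rightarrow> real) set \<Rightarrow> real" where
  "HX_norm \<Omega> X U = (THE r. \<forall>\<phi>\<in>U. (\<lambda>n. X_norm \<Omega> X (\<phi> n)) \<longlonglongrightarrow> r)"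

text \<open>The continuous extension of \<open>(u, v) \<mapsto> \<integral>\<^sub>\<Omega> B\<nabla>u\<cdot>\<nabla>v\<close> from \<open>C1_0 \<Omega>\<close> to the completion.\<close>

definition HX_form ::
  "(real^'n::finite) set \<Rightarrow> (real^'n \<Rightarrow> real^'n^'n) \<Rightarrow>
   (nat \<Rightarrow> real^'n \<Rightarrow> real) set \<Rightarrow> (nat \<Rightarrow> real^'n \<Rightarrow> real) set \<Rightarrow> real" where
  "HX_form \<Omega> B U V = (THE r. \<forall>\<phi>\<in>U. \<forall>\<psi>\<in>V.
     (\<lambda>n. \<integral>x. (B x *v grad (\<phi> n) x) \<bullet> grad (\<psi> n) x \<partial>lebesgue_on \<Omega>) \<longlonglongrightarrow> r)"

section \<open>Elements of the completion as functions\<close>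

text \<open>The inclusion of \<open>C1_0 \<Omega>\<close> into \<open>L\<^sup>p\<close> extends to the completion by taking limits of Cauchy
  sequences. On a bounded \<open>\<Omega>\<close> convergence in \<open>L\<^sup>p\<close>, \<open>p \<ge> 1\<close>, implies convergence in
  \<open>L\<^sup>1\<close>, so the function attached to \<open>U\<close>, unique up to null sets, is the \<open>L\<^sup>1\<close> limit,
  independently of \<open>p\<close>.\<close>

definition HX_represents ::
  "(real^'n::finite) set \<Rightarrow> (nat \<Rightarrow> real^'n \<Rightarrow> real) set \<Rightarrow> (real^'n \<Rightarrow> real) \<Rightarrow> bool" where
  "HX_represents \<Omega> U u \<longleftrightarrow> u \<in> Lp_space (lebesgue_on \<Omega>) 1 \<and>
     (\<forall>\<phi>\<in>U. (\<lambda>n. Lp_norm (lebesgue_on \<Omega>) 1 (\<lambda>x. \<phi> n x - u x)) \<longlonglongrightarrow> 0)"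

definition HX_fun ::
  "(real^'n::finite) set \<Rightarrow> (nat \<Rightarrow> real^'n \<Rightarrow> real) set \<Rightarrow> real^'n \<Rightarrow> real" where
  "HX_fun \<Omega> U = (SOME u. HX_represents \<Omega> U u)"

text \<open>The second conjunct is injectivity of the embedding.\<close>

definition HX_embeds ::
  "(real^'n::finite) set \<Rightarrow> ('m::finite \<Rightarrow> real^'n \<Rightarrow> real^'n) \<Rightarrow> real \<Rightarrow> bool" where
  "HX_embeds \<Omega> X p \<longleftrightarrow>
     (\<forall>U\<in>HX \<Omega> X. HX_represents \<Omega> U (HX_fun \<Omega> U) \<and> HX_fun \<Omega> U \<in> Lp_space (lebesgue_on \<Omega>) p) \<and>
     (\<forall>U\<in>HX \<Omega> X. \<forall>V\<in>HX \<Omega> X. (AE x in lebesgue_on \<Omega>. HX_fun \<Omega> U x = HX_fun \<Omega> V x) \<longrightarrow> U = V) \<and>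
     (\<exists>C. \<forall>U\<in>HX \<Omega> X. Lp_norm (lebesgue_on \<Omega>) p (HX_fun \<Omega> U) \<le> C * HX_norm \<Omega> X U)"

definition HX_compactly_embeds ::
  "(real^'n::finite) set \<Rightarrow> ('m::finite \<Rightarrow> real^'n \<Rightarrow> real^'n) \<Rightarrow> real \<Rightarrow> bool" where
  "HX_compactly_embeds \<Omega> X p \<longleftrightarrow> HX_embeds \<Omega> X p \<and>
     (\<forall>U :: nat \<Rightarrow> (nat \<Rightarrow> real^'n \<Rightarrow> real) set.
        (\<forall>n. U n \<in> HX \<Omega> X) \<and> (\<exists>C. \<forall>n. HX_norm \<Omega> X (U n) \<le> C) \<longrightarrow>
        (\<exists>r g. strict_mono r \<and> g \<in> Lp_space (lebesgue_on \<Omega>) p \<and>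
           (\<lambda>n. Lp_norm (lebesgue_on \<Omega>) p (\<lambda>x. HX_fun \<Omega> (U (r n)) x - g x)) \<longlonglongrightarrow> 0))"

text \<open>Assumption (S), with \<open>q\<close> playing the role of the exponent \<open>2\<^sup>*\<^sub>X\<close>.\<close>

definition assumption_S ::
  "(real^'n::finite) set \<Rightarrow> ('m::finite \<Rightarrow> real^'n \<Rightarrow> real^'n) \<Rightarrow> real \<Rightarrow> bool" where
  "assumption_S \<Omega> X q \<longleftrightarrow> q > 2 \<and>
     (\<forall>p\<in>{1..q}. HX_embeds \<Omega> X p) \<and> (\<forall>p\<in>{1..<q}. HX_compactly_embeds \<Omega> X p)"

definition N_X :: "real \<Rightarrow> real" where
  "N_X q = 2 * q / (q - 2)"

section \<open>Weak solutions\<close>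

definition weak_solution ::
  "(real^'n::finite) set \<Rightarrow> ('m::finite \<Rightarrow> real^'n \<Rightarrow> real^'n) \<Rightarrow> (real^'n \<Rightarrow> real^'n^'n) \<Rightarrow>
   (real^'n \<Rightarrow> real) \<Rightarrow> (real^'n \<Rightarrow> real) \<Rightarrow> (nat \<Rightarrow> real^'n \<Rightarrow> real) set \<Rightarrow> bool" where
  "weak_solution \<Omega> X B a f U \<longleftrightarrow> U \<in> HX \<Omega> X \<and>
     integrable (lebesgue_on \<Omega>) (\<lambda>x. a x * HX_fun \<Omega> U x) \<and>
     (\<forall>V\<in>HX \<Omega> X. HX_fun \<Omega> V \<in> Linf_space (lebesgue_on \<Omega>) \<longrightarrow>
        HX_form \<Omega> B U V + (\<integral>x. a x * HX_fun \<Omega> U x * HX_fun \<Omega> V x \<partial>lebesgue_on \<Omega>)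
          = (\<integral>x. f x * HX_fun \<Omega> V x \<partial>lebesgue_on \<Omega>))"

end

theory Submission
  imports Defs
begin

text \<open>Existence is the Riesz representation theorem for the form
  \<open>E u v = \<integral> B\<nabla>u\<cdot>\<nabla>v + \<integral> a u v\<close>. The condition \<open>\<bar>f\<bar> \<le> Q * a + R\<close> makes \<open>v \<mapsto> \<integral> f v\<close> continuous
  for it: \<open>\<integral> a \<bar>v\<bar>\<close> is bounded by \<open>\<integral> a v\<^sup>2\<close> and the integral of \<open>a\<close>, while \<open>\<integral> R \<bar>v\<bar>\<close> is bounded
  by the X-norm of \<open>v\<close>, because \<open>R\<close> lies in the dual of \<open>L\<^sup>q\<close> (\<open>dual_exponent_pairing_bound\<close>). As
  the completion is built from Cauchy sequences, \<open>E v v - 2 * \<integral> f v\<close> is minimised on \<open>C1_0 \<Omega>\<close>; a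
  minimising sequence is Cauchy (\<open>approximate_Riesz\<close>) and its class is the solution
  (\<open>weak_solution_exists\<close>).

  Two points of the weak formulation go beyond this. Test functions are bounded elements of the
  completion; such an element is the class of a uniformly bounded sequence in \<open>C1_0 \<Omega>\<close>
  (\<open>bounded_test_sequence\<close>), so dominated convergence applies. And uniqueness is claimed among all
  \<open>u\<close> with \<open>a * u\<close> integrable; there the difference \<open>w\<close> of two solutions is tested with
  \<open>arctan w\<close>, which gives
  \<open>\<parallel>arctan w\<parallel>\<^sub>X\<^sup>2 \<le> \<Lambda> * \<integral> B\<nabla>w\<cdot>\<nabla>(arctan w) = - \<Lambda> * \<integral> a w (arctan w) \<le> 0\<close>
  (\<open>weak_solution_unique\<close>).

  Both use that a smooth truncation \<open>S\<close> with \<open>S 0 = 0\<close> and \<open>0 < S' \<le> 1\<close> acts on the completion: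
  if \<open>\<phi>\<close> is Cauchy in the X-norm and converges in \<open>L\<^sup>1\<close> to \<open>u\<close>, then \<open>S \<circ> \<phi> n\<close> is Cauchy in the
  X-norm with limit \<open>S \<circ> u\<close> (\<open>trunc_X_Cauchy\<close>, \<open>HX_class_trunc\<close>).\<close>

section \<open>Positive semidefinite bilinear forms\<close>

locale psd_form =
  fixes V :: "('a \<Rightarrow> real) set" and E :: "('a \<Rightarrow> real) \<Rightarrow> ('a \<Rightarrow> real) \<Rightarrow> real"
  assumes closed: "u \<in> V \<Longrightarrow> v \<in> V \<Longrightarrow> (\<lambda>x. u x + c * v x) \<in> V"
    and sym: "u \<in> V \<Longrightarrow> v \<in> V \<Longrightarrow> E u v = E v u"
    and linear_left: "u \<in> V \<Longrightarrow> v \<in> V \<Longrightarrow> w \<in> V \<Longrightarrow>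
      E (\<lambda>x. u x + c * v x) w = E u w + c * E v w"
    and nonneg: "u \<in> V \<Longrightarrow> 0 \<le> E u u"
begin

lemma diff_closed: "u \<in> V \<Longrightarrow> v \<in> V \<Longrightarrow> (\<lambda>x. u x - v x) \<in> V"
  using closed[of u v "-1"] by simp

lemma linear_right:
  assumes "u \<in> V" "v \<in> V" "w \<in> V"
  shows "E w (\<lambda>x. u x + c * v x) = E w u + c * E w v"
  using assms closed[of u v c] linear_left[of u v w c] sym by metis

lemma diff_left: "u \<in> V \<Longrightarrow> v \<in> V \<Longrightarrow> w \<in> V \<Longrightarrow> E (\<lambda>x. u x - v x) w = E u w - E v w"
  using linear_left[of u v w "-1"] by simp

lemma diff_right: "u \<in> V \<Longrightarrow> v \<in> V \<Longrightarrow> w \<in> V \<Longrightarrow> E w (\<lambda>x. u x - v x) = E w u - E w v"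
  using linear_right[of u v w "-1"] by simp

lemma square:
  assumes "u \<in> V" "v \<in> V"
  shows "E (\<lambda>x. u x + c * v x) (\<lambda>x. u x + c * v x) = E u u + 2 * c * E u v + c\<^sup>2 * E v v"
  using assms closed[of u v c] sym[of u v]
  by (simp add: linear_left linear_right power2_eq_square algebra_simps)

lemma square_diff:
  assumes "u \<in> V" "v \<in> V"
  shows "E (\<lambda>x. u x - v x) (\<lambda>x. u x - v x) = E u u - 2 * E u v + E v v"
  using square[OF assms, of "-1"] by simp

lemma Cauchy_Schwarz:
  assumes "u \<in> V" "v \<in> V"
  shows "(E u v)\<^sup>2 \<le> E u u * E v v"
proof -
  have pos: "0 \<le> E u u + 2 * c * E u v + c\<^sup>2 * E v v" for c
    using nonneg[OF closed[OF assms]] square[OF assms] by metis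
  show ?thesis
  proof (cases "E v v = 0")
    case True
    have "E u v = 0"
    proof (rule ccontr)
      assume "E u v \<noteq> 0"
      then show False
        using pos[of "- (E u u + 1) / (2 * E u v)"] True by (simp add: field_simps)
    qed
    then show ?thesis using True by simp
  next
    case False
    then have d: "E v v > 0" using nonneg[OF assms(2)] by simp
    have "0 \<le> E v v * (E u u + 2 * (- E u v / E v v) * E u v + (- E u v / E v v)\<^sup>2 * E v v)"
      using pos[of "- E u v / E v v"] d by (intro mult_nonneg_nonneg) auto
    also have "\<dots> = E u u * E v v - (E u v)\<^sup>2"
      using d by (simp add: field_simps power2_eq_square)
    finally show ?thesis by simp
  qed
qed

lemma abs_le:
  assumes "u \<in> V" "v \<in> V"
  shows "\<bar>E u v\<bar> \<le> sqrt (E u u) * sqrt (E v v)"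
  using real_sqrt_le_mono[OF Cauchy_Schwarz[OF assms]] by (simp add: real_sqrt_mult)

lemma triangle:
  assumes "u \<in> V" "v \<in> V"
  shows "sqrt (E (\<lambda>x. u x - v x) (\<lambda>x. u x - v x)) \<le> sqrt (E u u) + sqrt (E v v)"
proof -
  have "E (\<lambda>x. u x - v x) (\<lambda>x. u x - v x) \<le> (sqrt (E u u) + sqrt (E v v))\<^sup>2"
    using abs_le[OF assms] nonneg[OF assms(1)] nonneg[OF assms(2)]
    by (simp add: square_diff[OF assms] power2_sum)
  then show ?thesis
    by (intro real_le_lsqrt add_nonneg_nonneg real_sqrt_ge_zero nonneg assms)
qed

lemma triangle3:
  assumes "u \<in> V" "v \<in> V" "w \<in> V"
  shows "sqrt (E (\<lambda>x. u x - w x) (\<lambda>x. u x - w x))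
    \<le> sqrt (E (\<lambda>x. u x - v x) (\<lambda>x. u x - v x)) + sqrt (E (\<lambda>x. w x - v x) (\<lambda>x. w x - v x))"
  using triangle[OF diff_closed[OF assms(1,2)] diff_closed[OF assms(3,2)]] by simp

text \<open>The Riesz representation theorem without completeness: instead of a representing vector one
  obtains a Cauchy sequence that represents the functional in the limit. It is a minimising
  sequence of \<open>J v = E v v - 2 * l v\<close>, whose lower bound is the assumption. The parallelogram law
  makes it Cauchy, and near-minimality along \<open>u + t * v\<close> forces \<open>E u v \<approx> l v\<close>.\<close>

lemma approximate_Riesz:
  assumes ne: "V \<noteq> {}"
    and l_lin: "\<And>u v c. u \<in> V \<Longrightarrow> v \<in> V \<Longrightarrow> l (\<lambda>x. u x + c * v x) = l u + c * l v"
    and l_bound: "\<And>v. v \<in> V \<Longrightarrow> 2 * l v \<le> E v v + C"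
  obtains \<phi> where "\<And>n. \<phi> n \<in> V"
    and "\<And>e. e > 0 \<Longrightarrow> \<exists>M. \<forall>m\<ge>M. \<forall>n\<ge>M.
           E (\<lambda>x. \<phi> m x - \<phi> n x) (\<lambda>x. \<phi> m x - \<phi> n x) < e"
    and "\<And>v. v \<in> V \<Longrightarrow> (\<lambda>n. E (\<phi> n) v) \<longlonglongrightarrow> l v"
proof -
  define J where "J v = E v v - 2 * l v" for v
  define I where "I = Inf (J ` V)"
  have bdd: "bdd_below (J ` V)"
    using l_bound by (intro bdd_belowI2[where m = "-C"]) (auto simp: J_def algebra_simps)
  have I_le: "I \<le> J v" if "v \<in> V" for v
    unfolding I_def using that bdd by (auto intro: cInf_lower)
  have "\<exists>v\<in>V. J v < I + 1 / (real n + 1)" for n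
    using cInf_lessD[of "J ` V" "I + 1 / (real n + 1)"] ne by (auto simp: I_def)
  then obtain \<phi> where \<phi>: "\<And>n. \<phi> n \<in> V" "\<And>n. J (\<phi> n) < I + 1 / (real n + 1)"
    by metis
  have eps: "(\<lambda>n. 1 / (real n + 1)) \<longlonglongrightarrow> 0"
    using LIMSEQ_inverse_real_of_nat by (simp add: inverse_eq_divide add.commute)
  have cauchy: "\<exists>M. \<forall>m\<ge>M. \<forall>n\<ge>M. E (\<lambda>x. \<phi> m x - \<phi> n x) (\<lambda>x. \<phi> m x - \<phi> n x) < e"
    if e: "e > 0" for e
  proof -
    have "eventually (\<lambda>n. 1 / (real n + 1) < e / 4) sequentially"
      using eps e by (intro order_tendstoD) auto
    then obtain M where M: "\<And>n. n \<ge> M \<Longrightarrow> 1 / (real n + 1) < e / 4"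
      by (auto simp: eventually_sequentially)
    have "E (\<lambda>x. \<phi> m x - \<phi> n x) (\<lambda>x. \<phi> m x - \<phi> n x) < e" if mn: "m \<ge> M" "n \<ge> M" for m n
    proof -
      \<comment> \<open>The midpoint of \<open>\<phi> m\<close> and \<open>\<phi> n\<close>, in the shape to which \<open>closed\<close> and \<open>square\<close> apply.\<close>
      define h where "h = (\<lambda>x. \<phi> n x + (1/2) * (\<phi> m x - \<phi> n x))"
      have d: "(\<lambda>x. \<phi> m x - \<phi> n x) \<in> V" using \<phi> diff_closed by blast
      have hV: "h \<in> V" unfolding h_def using \<phi> d by (intro closed) auto
      have lh: "l (\<lambda>x. \<phi> m x - \<phi> n x) = l (\<phi> m) - l (\<phi> n)"
        using l_lin[of "\<phi> m" "\<phi> n" "-1"] \<phi> by simp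
      have "l h = (l (\<phi> m) + l (\<phi> n)) / 2"
        unfolding h_def using l_lin[of "\<phi> n" "\<lambda>x. \<phi> m x - \<phi> n x" "1/2"] \<phi> d lh
        by (simp add: field_simps)
      moreover have "E h h = (E (\<phi> m) (\<phi> m) + 2 * E (\<phi> m) (\<phi> n) + E (\<phi> n) (\<phi> n)) / 4"
        unfolding h_def using square[of "\<phi> n" "\<lambda>x. \<phi> m x - \<phi> n x" "1/2"] \<phi> d sym[of "\<phi> m" "\<phi> n"]
        by (simp add: square_diff diff_right power2_eq_square field_simps)
      ultimately have "E (\<lambda>x. \<phi> m x - \<phi> n x) (\<lambda>x. \<phi> m x - \<phi> n x)
          = 2 * J (\<phi> m) + 2 * J (\<phi> n) - 4 * J h"
        unfolding J_def by (simp add: square_diff \<phi> field_simps)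
      then show ?thesis
        using I_le[OF hV] \<phi>(2)[of m] \<phi>(2)[of n] M[OF mn(1)] M[OF mn(2)] by linarith
    qed
    then show ?thesis by blast
  qed
  have conv: "(\<lambda>n. E (\<phi> n) v) \<longlonglongrightarrow> l v" if v: "v \<in> V" for v
  proof -
    have *: "(E (\<phi> n) v - l v)\<^sup>2 \<le> (1 / (real n + 1)) * (E v v + 1)" for n
    proof -
      define d where "d = E (\<phi> n) v - l v"
      \<comment> \<open>The step that minimises the quadratic in \<open>t\<close>, with \<open>E v v\<close> enlarged to avoid dividing
        by zero.\<close>
      define t where "t = - d / (E v v + 1)"
      have k: "E v v + 1 > 0" using nonneg[OF v] by simp
      have "J (\<lambda>x. \<phi> n x + t * v x) = J (\<phi> n) + 2 * t * d + t\<^sup>2 * E v v"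
        unfolding J_def d_def using \<phi> v by (simp add: square l_lin algebra_simps)
      moreover have "I \<le> J (\<lambda>x. \<phi> n x + t * v x)"
        using \<phi> v by (intro I_le closed)
      ultimately have "0 \<le> 1 / (real n + 1) + 2 * t * d + t\<^sup>2 * E v v"
        using \<phi>(2)[of n] by linarith
      also have "\<dots> \<le> 1 / (real n + 1) + 2 * t * d + t\<^sup>2 * (E v v + 1)"
        by (simp add: mult_left_mono)
      also have "\<dots> = 1 / (real n + 1) - d\<^sup>2 / (E v v + 1)"
      proof -
        have "t * (E v v + 1) = - d" unfolding t_def using k by simp
        then have "t\<^sup>2 * (E v v + 1) = t * (- d)" by (metis mult.assoc power2_eq_square)
        moreover have "t * d = - (d\<^sup>2 / (E v v + 1))"
          by (simp add: t_def power2_eq_square)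
        ultimately show ?thesis by simp
      qed
      finally have "d\<^sup>2 / (E v v + 1) \<le> 1 / (real n + 1)" by simp
      then show ?thesis
        unfolding d_def[symmetric] using k by (simp only: pos_divide_le_eq)
    qed
    have "(\<lambda>n. (1 / (real n + 1)) * (E v v + 1)) \<longlonglongrightarrow> 0"
      using tendsto_mult_right[OF eps, of "E v v + 1"] by simp
    then have "(\<lambda>n. (E (\<phi> n) v - l v)\<^sup>2) \<longlonglongrightarrow> 0"
      by (rule Lim_null_comparison[rotated]) (use * in auto)
    then have "(\<lambda>n. E (\<phi> n) v - l v) \<longlonglongrightarrow> 0"
      by (simp add: power_tendsto_0_iff)
    then show ?thesis by (simp add: LIM_zero_iff)
  qed
  show thesis using that \<phi>(1) cauchy conv by blast
qed

end

section \<open>A smooth truncation\<close>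

text \<open>The function \<open>trunc k\<close> is bounded, is the identity on \<open>{-k..k}\<close> and continues outside with
  shifted copies of the arc tangent. It is continuously differentiable, unlike the piecewise linear
  truncation, so it maps \<open>C1_0 \<Omega>\<close> to itself; and \<open>trunc 0\<close> is the arc tangent.\<close>

definition clamp :: "real \<Rightarrow> real \<Rightarrow> real" where
  "clamp k t = max (- k) (min k t)"

definition trunc :: "real \<Rightarrow> real \<Rightarrow> real" where
  "trunc k t = clamp k t + arctan (t - clamp k t)"

definition trunc' :: "real \<Rightarrow> real \<Rightarrow> real" where
  "trunc' k t = 1 / (1 + (t - clamp k t)\<^sup>2)"

text \<open>The excess over the levels \<open>k\<close> and \<open>- k\<close> enters through \<open>y - arctan y\<close>, whose derivative
  vanishes at 0; so the positive parts do not destroy differentiability.\<close>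

lemma trunc_eq:
  assumes "k \<ge> 0"
  shows "trunc k t = t - (max 0 (t - k) - arctan (max 0 (t - k)))
                       + (max 0 (- t - k) - arctan (max 0 (- t - k)))"
proof -
  consider "\<bar>t\<bar> \<le> k" | "t > k" | "t < - k" by linarith
  then show ?thesis
  proof cases
    case 1
    then have "max 0 (t - k) = 0" "max 0 (- t - k) = 0" "clamp k t = t"
      by (auto simp: clamp_def)
    then show ?thesis by (simp add: trunc_def)
  next
    case 3
    then show ?thesis
      using assms arctan_minus[of "t + k"] by (simp add: trunc_def clamp_def)
  qed (use assms in \<open>auto simp: trunc_def clamp_def max_def min_def\<close>)
qed

lemma has_real_derivative_positive_part:
  "((\<lambda>y. max 0 y - arctan (max 0 y)) has_real_derivative (1 - 1 / (1 + (max 0 y)\<^sup>2))) (at (y::real))"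
proof -
  define g :: "real \<Rightarrow> real" where "g y = y - arctan y" for y
  have g: "(g has_real_derivative (1 - 1 / (1 + y\<^sup>2))) (at y)" for y
    unfolding g_def by (auto intro!: derivative_eq_intros simp: inverse_eq_divide)
  consider "y > 0" | "y < 0" | "y = 0" by linarith
  then have "((\<lambda>y. g (max 0 y)) has_real_derivative (1 - 1 / (1 + (max 0 y)\<^sup>2))) (at y)"
  proof cases
    case 1
    have "((\<lambda>y. g (max 0 y)) has_real_derivative (1 - 1 / (1 + y\<^sup>2))) (at y)"
      by (rule has_field_derivative_transform_within_open[OF g, of "{0<..}"]) (use 1 in auto)
    then show ?thesis using 1 by simp
  next
    case 2
    have "((\<lambda>y. g (max 0 y)) has_real_derivative 0) (at y)"
      by (rule has_field_derivative_transform_within_open[OF DERIV_const, where S = "{..<0}"])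
        (use 2 in \<open>auto simp: g_def\<close>)
    then show ?thesis using 2 by simp
  next
    case 3
    have "(\<lambda>h. g h / h) \<midarrow>0\<rightarrow> 0"
      using g[of 0] by (simp add: DERIV_def g_def)
    then have "(\<lambda>h. norm (g h / h)) \<midarrow>0\<rightarrow> 0" by (rule tendsto_norm_zero)
    then have "(\<lambda>h. g (max 0 h) / h) \<midarrow>0\<rightarrow> 0"
      by (rule Lim_null_comparison[rotated])
        (intro always_eventually allI, auto simp: max_def g_def divide_le_0_iff)
    then show ?thesis unfolding 3 by (simp add: DERIV_def g_def)
  qed
  then show ?thesis by (simp add: g_def)
qed

lemma trunc_has_derivative:
  assumes "k \<ge> 0"
  shows "(trunc k has_real_derivative trunc' k t) (at t)"
proof -
  have 1: "((\<lambda>t. max 0 (t - k) - arctan (max 0 (t - k)))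
      has_real_derivative (1 - 1 / (1 + (max 0 (t - k))\<^sup>2))) (at t)"
    using DERIV_shift[THEN iffD1, of "\<lambda>y. max 0 y - arctan (max 0 y)" _ t "- k"]
      has_real_derivative_positive_part[of "t - k"] by simp
  have 2: "((\<lambda>t. max 0 (- t - k) - arctan (max 0 (- t - k)))
      has_real_derivative - (1 - 1 / (1 + (max 0 (- t - k))\<^sup>2))) (at t)"
  proof -
    have "((\<lambda>t. - t - k) has_real_derivative - 1) (at t)"
      by (auto intro!: derivative_eq_intros)
    from DERIV_chain2[where g = "\<lambda>t. - t - k", OF has_real_derivative_positive_part this]
    show ?thesis by simp
  qed
  have "((\<lambda>t. t - (max 0 (t - k) - arctan (max 0 (t - k)))
                       + (max 0 (- t - k) - arctan (max 0 (- t - k)))) has_real_derivative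
      1 - (1 - 1 / (1 + (max 0 (t - k))\<^sup>2)) + - (1 - 1 / (1 + (max 0 (- t - k))\<^sup>2))) (at t)"
    by (intro DERIV_add DERIV_diff DERIV_ident 1 2)
  moreover have "1 - (1 - 1 / (1 + (max 0 (t - k))\<^sup>2)) + - (1 - 1 / (1 + (max 0 (- t - k))\<^sup>2))
      = trunc' k t"
  proof -
    consider "\<bar>t\<bar> \<le> k" | "t > k" | "t < - k" by linarith
    then show ?thesis
    proof cases
      case 1
      then have "max 0 (t - k) = 0" "max 0 (- t - k) = 0" "clamp k t = t"
        by (auto simp: clamp_def)
      then show ?thesis by (simp add: trunc'_def)
    qed (use assms in \<open>auto simp: trunc'_def clamp_def power2_eq_square algebra_simps\<close>)
  qed
  ultimately show ?thesis
    by (simp add: trunc_eq[OF assms, abs_def])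
qed

lemma trunc'_bounds: "0 < trunc' k t" "trunc' k t \<le> 1"
  by (auto simp: trunc'_def divide_simps add_pos_nonneg)

lemma trunc_zero [simp]: "k \<ge> 0 \<Longrightarrow> trunc k 0 = 0"
  by (simp add: trunc_def clamp_def)

lemma trunc_id: "\<bar>t\<bar> \<le> k \<Longrightarrow> trunc k t = t"
  by (simp add: trunc_def clamp_def)

lemma trunc_0: "trunc 0 t = arctan t"
  by (simp add: trunc_def clamp_def)

lemma trunc_bounded: "k \<ge> 0 \<Longrightarrow> \<bar>trunc k t\<bar> \<le> k + 2"
  using arctan_bounded[of "t - clamp k t"] pi_half_less_two
  by (auto simp: trunc_def clamp_def abs_le_iff max_def min_def split: if_splits)

lemma continuous_trunc': "continuous_on UNIV (trunc' k)"
proof -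
  have "1 + (t - clamp k t)\<^sup>2 \<noteq> 0" for t
    by (simp add: add_nonneg_eq_0_iff)
  then show ?thesis
    unfolding trunc'_def clamp_def by (intro continuous_intros) auto
qed

lemma trunc_Lipschitz:
  assumes "k \<ge> 0"
  shows "\<bar>trunc k s - trunc k t\<bar> \<le> \<bar>s - t\<bar>"
proof -
  have "norm (trunc k s - trunc k t) \<le> 1 * norm (s - t)"
    by (rule field_differentiable_bound[of UNIV "trunc k" "trunc' k"])
      (use trunc_has_derivative[OF assms] trunc'_bounds[of k] in \<open>simp_all add: abs_of_pos\<close>)
  then show ?thesis by simp
qed

lemma trunc'_Lipschitz: "\<bar>trunc' k s - trunc' k t\<bar> \<le> \<bar>s - t\<bar>"
proof -
  define x where "x = s - clamp k s"
  define y where "y = t - clamp k t"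
  have xy: "\<bar>x - y\<bar> \<le> \<bar>s - t\<bar>"
    by (auto simp: x_def y_def clamp_def max_def min_def)
  have p: "1 + x\<^sup>2 > 0" "1 + y\<^sup>2 > 0" by (auto simp: add_pos_nonneg)
  have "\<bar>x\<bar> \<le> (1 + x\<^sup>2) / 2" "\<bar>y\<bar> \<le> (1 + y\<^sup>2) / 2"
    using zero_le_power2[of "\<bar>x\<bar> - 1"] zero_le_power2[of "\<bar>y\<bar> - 1"]
    by (auto simp: power2_eq_square algebra_simps)
  moreover have "(1 + x\<^sup>2) / 2 + (1 + y\<^sup>2) / 2 \<le> (1 + x\<^sup>2) * (1 + y\<^sup>2)"
    by (simp add: field_simps)
  moreover have "\<bar>y + x\<bar> \<le> \<bar>x\<bar> + \<bar>y\<bar>" by simp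
  ultimately have "\<bar>y + x\<bar> \<le> (1 + x\<^sup>2) * (1 + y\<^sup>2)"
    by (meson add_mono order_trans)
  then have "\<bar>x - y\<bar> * \<bar>y + x\<bar> \<le> \<bar>x - y\<bar> * ((1 + x\<^sup>2) * (1 + y\<^sup>2))"
    by (simp add: mult_left_mono)
  moreover have "1 / (1 + x\<^sup>2) - 1 / (1 + y\<^sup>2) = (y - x) * (y + x) / ((1 + x\<^sup>2) * (1 + y\<^sup>2))"
    using p by (simp add: field_simps power2_eq_square)
  ultimately have "\<bar>1 / (1 + x\<^sup>2) - 1 / (1 + y\<^sup>2)\<bar> \<le> \<bar>x - y\<bar>"
    using p by (simp add: abs_mult abs_minus_commute pos_divide_le_eq)
  then show ?thesis using xy by (simp add: trunc'_def x_def y_def)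
qed

text \<open>The oscillation of \<open>trunc'\<close> is at most 1, hence its square is controlled to first order, that
  is, by convergence in \<open>L\<^sup>1\<close>.\<close>

lemma trunc'_diff_squared: "(trunc' k s - trunc' k t)\<^sup>2 \<le> \<bar>s - t\<bar>"
proof -
  have "\<bar>trunc' k s - trunc' k t\<bar> \<le> 1"
    using trunc'_bounds[of k s] trunc'_bounds[of k t] by linarith
  then have "\<bar>trunc' k s - trunc' k t\<bar> * \<bar>trunc' k s - trunc' k t\<bar> \<le> \<bar>s - t\<bar> * 1"
    using trunc'_Lipschitz[of k s t] by (intro mult_mono) auto
  then show ?thesis by (simp add: power2_eq_square)
qed

section \<open>Calculus of compactly supported functions\<close>

text \<open>\<open>grad\<close> is defined by partial derivatives. The two lemmas below identify it with the vector
  representing the total derivative, so that derivatives are computed without coordinates.\<close>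

lemma has_derivative_grad:
  fixes u :: "real^'n::finite \<Rightarrow> real"
  assumes "u differentiable (at x)"
  shows "(u has_derivative (\<lambda>h. grad u x \<bullet> h)) (at x)"
proof -
  have D: "(u has_derivative frechet_derivative u (at x)) (at x)"
    using assms by (simp add: frechet_derivative_works)
  then have lin: "linear (frechet_derivative u (at x))"
    by (rule has_derivative_linear)
  have "frechet_derivative u (at x) h = grad u x \<bullet> h" for h
  proof -
    have "h = (\<Sum>k\<in>UNIV. h $ k *\<^sub>R axis k 1)"
      by (simp add: vec_eq_iff axis_def if_distrib cong: if_cong)
    then have "frechet_derivative u (at x) h
        = frechet_derivative u (at x) (\<Sum>k\<in>UNIV. h $ k *\<^sub>R axis k 1)"
      by (rule arg_cong)
    also have "\<dots> = (\<Sum>k\<in>UNIV. h $ k * frechet_derivative u (at x) (axis k 1))"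
      by (simp add: linear_sum[OF lin] linear_scale[OF lin])
    finally show ?thesis by (simp add: grad_def inner_vec_def mult.commute)
  qed
  then show ?thesis using D by presburger
qed

lemma grad_unique:
  fixes u :: "real^'n::finite \<Rightarrow> real"
  assumes "(u has_derivative (\<lambda>h. g \<bullet> h)) (at x)"
  shows "grad u x = g"
  using frechet_derivative_at[OF assms, symmetric]
  by (simp add: grad_def inner_axis vec_eq_iff)

lemma X_deriv_eq_inner: "X_deriv Y u x = Y x \<bullet> grad u x"
  by (simp add: X_deriv_def inner_vec_def)

lemma C1_0_has_derivative: "u \<in> C1_0 \<Omega> \<Longrightarrow> (u has_derivative (\<lambda>h. grad u x \<bullet> h)) (at x)"
  by (simp add: C1_0_def has_derivative_grad)

lemma C1_0_continuous: "u \<in> C1_0 \<Omega> \<Longrightarrow> continuous_on UNIV u"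
  by (meson C1_0_has_derivative has_derivative_at_withinI has_derivative_continuous_on)

lemma C1_0_continuous_grad: "u \<in> C1_0 \<Omega> \<Longrightarrow> continuous_on UNIV (grad u)"
  by (simp add: C1_0_def)

lemma C1_0_vanish:
  assumes "u \<in> C1_0 \<Omega>"
  obtains K where "compact K" "K \<subseteq> \<Omega>" "\<And>x. x \<notin> K \<Longrightarrow> u x = 0" "\<And>x. x \<notin> K \<Longrightarrow> grad u x = 0"
proof
  let ?K = "closure {x. u x \<noteq> 0}"
  show "compact ?K" "?K \<subseteq> \<Omega>" using assms by (auto simp: C1_0_def)
  show z: "u x = 0" if "x \<notin> ?K" for x
    using that closure_subset[of "{x. u x \<noteq> 0}"] by auto
  show "grad u x = 0" if "x \<notin> ?K" for x
  proof (rule grad_unique)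
    have "((\<lambda>_. 0) has_derivative (\<lambda>h. 0 \<bullet> h)) (at x)" by simp
    then show "(u has_derivative (\<lambda>h. 0 \<bullet> h)) (at x)"
    proof (rule has_derivative_transform_within_open)
      show "open (- ?K)" by (intro open_Compl closed_closure)
      show "x \<in> - ?K" using that by blast
      show "0 = u y" if "y \<in> - ?K" for y
        using z[OF ComplD[OF that]] by (rule sym)
    qed
  qed
qed

lemma C1_0_I:
  fixes u :: "real^'n::finite \<Rightarrow> real"
  assumes "\<And>x. (u has_derivative (\<lambda>h. g x \<bullet> h)) (at x)" and "continuous_on UNIV g"
    and "compact K" "K \<subseteq> \<Omega>" and "\<And>x. x \<notin> K \<Longrightarrow> u x = 0"
  shows "u \<in> C1_0 \<Omega>"
proof -
  have "grad u = g" using grad_unique[OF assms(1)] by (intro ext)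
  moreover have sub: "closure {x. u x \<noteq> 0} \<subseteq> K"
    using assms(3,5) by (intro closure_minimal) (auto intro: compact_imp_closed)
  then have "compact (closure {x. u x \<noteq> 0})"
    using assms(3) by (metis closed_closure compact_Int_closed inf.absorb_iff2)
  moreover have "u differentiable (at x)" for x
    using assms(1) by (auto simp: differentiable_def)
  ultimately show ?thesis using assms(2,4) sub by (auto simp: C1_0_def)
qed

lemma C1_0_linear_combination:
  assumes u: "u \<in> C1_0 \<Omega>" and v: "v \<in> C1_0 \<Omega>"
  shows "(\<lambda>x. u x + c * v x) \<in> C1_0 \<Omega>"
    and "grad (\<lambda>x. u x + c * v x) x = grad u x + c *\<^sub>R grad v x"
proof -
  have D: "((\<lambda>x. u x + c * v x) has_derivative (\<lambda>h. (grad u x + c *\<^sub>R grad v x) \<bullet> h)) (at x)" for x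
    using has_derivative_add[OF C1_0_has_derivative[OF u, of x]
        has_derivative_mult_right[OF C1_0_has_derivative[OF v, of x], of c]]
    by (simp add: inner_left_distrib)
  then show "grad (\<lambda>x. u x + c * v x) x = grad u x + c *\<^sub>R grad v x"
    by (rule grad_unique)
  obtain K L where "compact K" "K \<subseteq> \<Omega>" "\<And>x. x \<notin> K \<Longrightarrow> u x = 0"
    "compact L" "L \<subseteq> \<Omega>" "\<And>x. x \<notin> L \<Longrightarrow> v x = 0"
    using C1_0_vanish[OF u] C1_0_vanish[OF v] by metis
  then show "(\<lambda>x. u x + c * v x) \<in> C1_0 \<Omega>"
    by (intro C1_0_I[OF D, of "K \<union> L"])
      (auto intro!: continuous_intros C1_0_continuous_grad[OF u] C1_0_continuous_grad[OF v])
qed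

lemma C1_0_diff:
  assumes u: "u \<in> C1_0 \<Omega>" and v: "v \<in> C1_0 \<Omega>"
  shows "(\<lambda>x. u x - v x) \<in> C1_0 \<Omega>" and "grad (\<lambda>x. u x - v x) x = grad u x - grad v x"
  using C1_0_linear_combination[OF assms, of "-1"] by auto

lemma C1_0_zero: "(\<lambda>x. 0) \<in> C1_0 \<Omega>"
  by (rule C1_0_I[where g = "\<lambda>_. 0" and K = "{}"]) auto

lemma C1_0_compose:
  assumes u: "u \<in> C1_0 \<Omega>" and S: "\<And>t. (S has_real_derivative s t) (at t)"
    and s: "continuous_on UNIV s" and "S 0 = 0"
  shows "(\<lambda>x. S (u x)) \<in> C1_0 \<Omega>" and "grad (\<lambda>x. S (u x)) x = s (u x) *\<^sub>R grad u x"
proof -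
  have D: "((\<lambda>x. S (u x)) has_derivative (\<lambda>h. (s (u x) *\<^sub>R grad u x) \<bullet> h)) (at x)" for x
    using has_derivative_compose[OF C1_0_has_derivative[OF u, of x]
        S[of "u x", unfolded has_field_derivative_def]]
    by simp
  then show "grad (\<lambda>x. S (u x)) x = s (u x) *\<^sub>R grad u x"
    by (rule grad_unique)
  obtain K where "compact K" "K \<subseteq> \<Omega>" "\<And>x. x \<notin> K \<Longrightarrow> u x = 0"
    using C1_0_vanish[OF u] by metis
  moreover have "continuous_on UNIV (\<lambda>x. s (u x) *\<^sub>R grad u x)"
    by (intro continuous_intros C1_0_continuous_grad[OF u]
        continuous_on_compose2[OF s C1_0_continuous[OF u]]) auto
  ultimately show "(\<lambda>x. S (u x)) \<in> C1_0 \<Omega>"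
    using assms(4) by (intro C1_0_I[OF D, of K]) auto
qed

lemma continuous_compact_support_bounded:
  fixes g :: "'a::euclidean_space \<Rightarrow> 'b::real_normed_vector"
  assumes "continuous_on UNIV g" "compact K" "\<And>x. x \<notin> K \<Longrightarrow> g x = 0"
  obtains C where "C \<ge> 0" "\<And>x. norm (g x) \<le> C"
proof -
  have "bounded (g ` K)"
    using assms by (intro compact_imp_bounded compact_continuous_image) (auto intro: continuous_on_subset)
  then obtain C where "C > 0" "\<And>x. x \<in> K \<Longrightarrow> norm (g x) \<le> C"
    by (auto simp: bounded_pos)
  then show thesis using that[of C] assms(3) by (metis less_imp_le norm_zero)
qed

lemma C1_0_bounded:
  assumes "u \<in> C1_0 \<Omega>"
  obtains C where "C \<ge> 0" "\<And>x. \<bar>u x\<bar> \<le> C"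
  using C1_0_vanish[OF assms] continuous_compact_support_bounded[OF C1_0_continuous[OF assms]]
  by (metis real_norm_def)

lemma continuous_of_locally_lipschitz_fields:
  assumes "locally_lipschitz_fields X"
  shows "continuous_on UNIV (X j)"
proof -
  have "isCont (\<lambda>y. X j y $ k) x" for k x
  proof -
    obtain e L where "e > 0" "L-lipschitz_on (cball x e) (\<lambda>y. X j y $ k)"
      using assms unfolding locally_lipschitz_fields_def by blast
    then have "continuous_on (ball x e) (\<lambda>y. X j y $ k)"
      using lipschitz_on_continuous_on continuous_on_subset ball_subset_cball by metis
    then show ?thesis
      using \<open>e > 0\<close> by (simp add: continuous_on_eq_continuous_at)
  qed
  then have "continuous_on UNIV (\<lambda>y. X j y $ k)" for k
    by (simp add: continuous_at_imp_continuous_on)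
  then have "continuous_on UNIV (\<lambda>y. \<chi> k. X j y $ k)"
    by (intro continuous_on_vec_lambda)
  then show ?thesis by simp
qed

lemma quadratic_form_eq_inner:
  "(\<Sum>i\<in>UNIV. \<Sum>j\<in>UNIV. A $ i $ j * \<xi> $ i * \<xi> $ j) = ((A :: real^'n::finite^'n) *v \<xi>) \<bullet> \<xi>"
  by (simp add: matrix_vector_mult_def inner_vec_def sum_distrib_right sum_distrib_left mult_ac)

section \<open>The bilinear forms of an X-elliptic operator\<close>

text \<open>The bounds on the quadratic form are both written as upper bounds with factor \<open>\<Lambda>\<close>, so that
  \<open>X_form\<close> and \<open>grad_form\<close> below dominate each other up to this factor.\<close>

locale X_elliptic =
  fixes \<Omega> :: "(real^'n::finite) set"
    and X :: "'m::finite \<Rightarrow> real^'n \<Rightarrow> real^'n"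
    and B :: "real^'n \<Rightarrow> real^'n^'n"
    and \<Lambda> :: real
  assumes open_domain: "open \<Omega>" and bounded_domain: "bounded \<Omega>"
    and continuous_X: "\<And>j. continuous_on UNIV (X j)"
    and B_measurable: "\<And>i j. (\<lambda>x. B x $ i $ j) \<in> borel_measurable lebesgue"
    and B_symmetric: "\<And>i j x. B x $ i $ j = B x $ j $ i"
    and \<Lambda>_pos: "\<Lambda> > 0"
    and elliptic_lower: "\<And>x \<xi>. x \<in> \<Omega> \<Longrightarrow> (\<Sum>j\<in>UNIV. (X j x \<bullet> \<xi>)\<^sup>2) \<le> \<Lambda> * ((B x *v \<xi>) \<bullet> \<xi>)"
    and elliptic_upper: "\<And>x \<xi>. x \<in> \<Omega> \<Longrightarrow> (B x *v \<xi>) \<bullet> \<xi> \<le> \<Lambda> * (\<Sum>j\<in>UNIV. (X j x \<bullet> \<xi>)\<^sup>2)"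
begin

abbreviation "M \<equiv> lebesgue_on \<Omega>"

definition grad_form :: "(real^'n \<Rightarrow> real) \<Rightarrow> (real^'n \<Rightarrow> real) \<Rightarrow> real" where
  "grad_form \<phi> \<psi> = (\<integral>x. (B x *v grad \<phi> x) \<bullet> grad \<psi> x \<partial>M)"

definition X_form :: "(real^'n \<Rightarrow> real) \<Rightarrow> (real^'n \<Rightarrow> real) \<Rightarrow> real" where
  "X_form \<phi> \<psi> = (\<integral>x. (\<Sum>j\<in>UNIV. X_deriv (X j) \<phi> x * X_deriv (X j) \<psi> x) \<partial>M)"

lemma X_norm_eq: "X_norm \<Omega> X \<phi> = sqrt (X_form \<phi> \<phi>)"
  by (simp add: X_norm_def X_form_def power2_eq_square)

lemma domain_measurable: "\<Omega> \<in> sets lebesgue"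
  using open_domain by (simp add: lborelD)

sublocale finite_measure M
  using open_domain bounded_domain
  by (intro finite_measure_lebesgue_on) (simp add: lmeasurable_open)

lemma measurable_continuous:
  assumes "continuous_on UNIV (g :: real^'n \<Rightarrow> 'b::euclidean_space)"
  shows "g \<in> borel_measurable M"
  using assms domain_measurable
  by (intro continuous_imp_measurable_on_sets_lebesgue) (auto intro: continuous_on_subset)

lemma measurable_C1_0: "u \<in> C1_0 \<Omega> \<Longrightarrow> u \<in> borel_measurable M"
  by (intro measurable_continuous C1_0_continuous)

lemma measurable_B: "(\<lambda>x. B x $ i $ j) \<in> borel_measurable M"
  by (intro measurable_restrict_space1 B_measurable)

lemma integrable_bounded:
  assumes "f \<in> borel_measurable M" "\<And>x. \<bar>f x\<bar> \<le> (C::real)"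
  shows "integrable M f"
  using assms by (intro integrable_const_bound[where B = C]) auto

lemma integrable_C1_0: "u \<in> C1_0 \<Omega> \<Longrightarrow> integrable M u"
  by (metis C1_0_bounded integrable_bounded measurable_C1_0)

lemma X_deriv_bounded:
  assumes "u \<in> C1_0 \<Omega>"
  obtains C where "C \<ge> 0" "\<And>x. \<bar>X_deriv (X j) u x\<bar> \<le> C"
proof -
  obtain K where K: "compact K" "\<And>x. x \<notin> K \<Longrightarrow> grad u x = 0"
    using C1_0_vanish[OF assms] by metis
  have "continuous_on UNIV (X_deriv (X j) u)"
    unfolding X_deriv_eq_inner[abs_def]
    by (intro continuous_intros continuous_X C1_0_continuous_grad[OF assms])
  then obtain C where "C \<ge> 0" "\<And>x. norm (X_deriv (X j) u x) \<le> C"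
    by (rule continuous_compact_support_bounded[OF _ K(1)]) (auto simp: X_deriv_eq_inner K(2))
  then show thesis using that by auto
qed

lemma measurable_X_deriv:
  assumes "u \<in> C1_0 \<Omega>"
  shows "X_deriv (X j) u \<in> borel_measurable M"
  unfolding X_deriv_eq_inner[abs_def]
  by (intro measurable_continuous continuous_intros continuous_X C1_0_continuous_grad[OF assms])

lemma integrable_X_form:
  assumes u: "u \<in> C1_0 \<Omega>" and v: "v \<in> C1_0 \<Omega>"
  shows "integrable M (\<lambda>x. \<Sum>j\<in>UNIV. X_deriv (X j) u x * X_deriv (X j) v x)"
proof (intro Bochner_Integration.integrable_sum)
  fix j
  obtain C D where "C \<ge> 0" "\<And>x. \<bar>X_deriv (X j) u x\<bar> \<le> C" "D \<ge> 0" "\<And>x. \<bar>X_deriv (X j) v x\<bar> \<le> D"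
    using X_deriv_bounded[OF u] X_deriv_bounded[OF v] by metis
  then show "integrable M (\<lambda>x. X_deriv (X j) u x * X_deriv (X j) v x)"
    by (intro integrable_bounded[where C = "C * D"] borel_measurable_times measurable_X_deriv u v)
      (simp add: abs_mult mult_mono)
qed

lemma integrable_X_square: "u \<in> C1_0 \<Omega> \<Longrightarrow> integrable M (\<lambda>x. \<Sum>j\<in>UNIV. (X_deriv (X j) u x)\<^sup>2)"
  using integrable_X_form[of u u] by (simp add: power2_eq_square)

lemma X_form_self: "X_form u u = (\<integral>x. (\<Sum>j\<in>UNIV. (X_deriv (X j) u x)\<^sup>2) \<partial>M)"
  by (simp add: X_form_def power2_eq_square)

lemma B_sym_inner: "(B x *v \<xi>) \<bullet> \<eta> = (B x *v \<eta>) \<bullet> \<xi>"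
proof -
  have "transpose (B x) = B x"
    by (simp add: transpose_def vec_eq_iff B_symmetric)
  then show ?thesis by (metis dot_lmul_matrix inner_commute vector_transpose_matrix)
qed

lemma B_nonneg:
  assumes "x \<in> \<Omega>" shows "0 \<le> (B x *v \<xi>) \<bullet> \<xi>"
proof -
  have "0 \<le> \<Lambda> * ((B x *v \<xi>) \<bullet> \<xi>)"
    using elliptic_lower[OF assms, of \<xi>] sum_nonneg[of UNIV "\<lambda>j. (X j x \<bullet> \<xi>)\<^sup>2"] by simp
  then show ?thesis using \<Lambda>_pos by (simp add: zero_le_mult_iff)
qed

text \<open>The ellipticity condition bounds only the quadratic form of \<open>B x\<close>. The bilinear form follows
  by expanding the nonnegative values at \<open>\<xi> + \<eta>\<close> and \<open>\<xi> - \<eta>\<close>; this crude bound serves to show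
  integrability, the sharp one is \<open>abs_grad_form_le\<close>.\<close>

lemma B_abs_le:
  assumes "x \<in> \<Omega>"
  shows "\<bar>(B x *v \<xi>) \<bullet> \<eta>\<bar> \<le> \<Lambda> * (\<Sum>j\<in>UNIV. (X j x \<bullet> \<xi>)\<^sup>2) + \<Lambda> * (\<Sum>j\<in>UNIV. (X j x \<bullet> \<eta>)\<^sup>2)"
proof -
  have "2 * \<bar>(B x *v \<xi>) \<bullet> \<eta>\<bar> \<le> (B x *v \<xi>) \<bullet> \<xi> + (B x *v \<eta>) \<bullet> \<eta>"
    using B_nonneg[OF assms, of "\<xi> + \<eta>"] B_nonneg[OF assms, of "\<xi> - \<eta>"] B_sym_inner[of x \<eta> \<xi>]
    by (simp add: matrix_vector_right_distrib matrix_vector_mult_diff_distrib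
        inner_add_left inner_add_right inner_diff_left inner_diff_right)
  then show ?thesis
    using elliptic_upper[OF assms, of \<xi>] elliptic_upper[OF assms, of \<eta>] by linarith
qed

lemma integrable_grad_form:
  assumes u: "u \<in> C1_0 \<Omega>" and v: "v \<in> C1_0 \<Omega>"
  shows "integrable M (\<lambda>x. (B x *v grad u x) \<bullet> grad v x)"
proof (rule Bochner_Integration.integrable_bound)
  show "integrable M (\<lambda>x. \<Lambda> * (\<Sum>j\<in>UNIV. (X_deriv (X j) u x)\<^sup>2) + \<Lambda> * (\<Sum>j\<in>UNIV. (X_deriv (X j) v x)\<^sup>2))"
    by (intro Bochner_Integration.integrable_add integrable_mult_right integrable_X_square u v)
  have g: "(\<lambda>x. grad w x $ i) \<in> borel_measurable M" if "w \<in> C1_0 \<Omega>" for w i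
    by (intro measurable_continuous continuous_intros C1_0_continuous_grad[OF that])
  show "(\<lambda>x. (B x *v grad u x) \<bullet> grad v x) \<in> borel_measurable M"
    unfolding inner_vec_def matrix_vector_mult_def
    by (simp, intro borel_measurable_sum borel_measurable_times measurable_B g u v)
  show "AE x in M. norm ((B x *v grad u x) \<bullet> grad v x)
      \<le> norm (\<Lambda> * (\<Sum>j\<in>UNIV. (X_deriv (X j) u x)\<^sup>2) + \<Lambda> * (\<Sum>j\<in>UNIV. (X_deriv (X j) v x)\<^sup>2))"
  proof (intro AE_I2)
    fix x assume "x \<in> space M"
    then have "x \<in> \<Omega>" by simp
    then show "norm ((B x *v grad u x) \<bullet> grad v x)
      \<le> norm (\<Lambda> * (\<Sum>j\<in>UNIV. (X_deriv (X j) u x)\<^sup>2) + \<Lambda> * (\<Sum>j\<in>UNIV. (X_deriv (X j) v x)\<^sup>2))"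
      using B_abs_le[of x "grad u x" "grad v x"] by (simp add: X_deriv_eq_inner)
  qed
qed

lemma X_deriv_linear_combination:
  "u \<in> C1_0 \<Omega> \<Longrightarrow> v \<in> C1_0 \<Omega> \<Longrightarrow>
    X_deriv Y (\<lambda>x. u x + c * v x) x = X_deriv Y u x + c * X_deriv Y v x"
  by (simp add: X_deriv_eq_inner C1_0_linear_combination inner_add_right)

lemma X_deriv_diff:
  "u \<in> C1_0 \<Omega> \<Longrightarrow> v \<in> C1_0 \<Omega> \<Longrightarrow>
    X_deriv Y (\<lambda>x. u x - v x) x = X_deriv Y u x - X_deriv Y v x"
  by (simp add: X_deriv_eq_inner C1_0_diff inner_diff_right)

sublocale X: psd_form "C1_0 \<Omega>" X_form
proof
  fix u v w :: "real^'n \<Rightarrow> real" and c :: real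
  assume u: "u \<in> C1_0 \<Omega>" 
  show "0 \<le> X_form u u"
    unfolding X_form_self by (intro integral_nonneg_AE AE_I2 sum_nonneg) auto
  assume v: "v \<in> C1_0 \<Omega>"
  show "(\<lambda>x. u x + c * v x) \<in> C1_0 \<Omega>"
    using u v by (rule C1_0_linear_combination)
  show "X_form u v = X_form v u"
    by (simp add: X_form_def mult.commute)
  assume w: "w \<in> C1_0 \<Omega>"
  have "X_form (\<lambda>x. u x + c * v x) w = (\<integral>x. (\<Sum>j\<in>UNIV. X_deriv (X j) u x * X_deriv (X j) w x)
      + c * (\<Sum>j\<in>UNIV. X_deriv (X j) v x * X_deriv (X j) w x) \<partial>M)"
    by (simp add: X_form_def X_deriv_linear_combination[OF u v] sum.distrib[symmetric]
        sum_distrib_left algebra_simps)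
  then show "X_form (\<lambda>x. u x + c * v x) w = X_form u w + c * X_form v w"
    using integrable_X_form[OF u w] integrable_X_form[OF v w] by (simp add: X_form_def)
qed

sublocale G: psd_form "C1_0 \<Omega>" grad_form
proof
  fix u v w :: "real^'n \<Rightarrow> real" and c :: real
  assume u: "u \<in> C1_0 \<Omega>" 
  show "0 \<le> grad_form u u"
    unfolding grad_form_def by (intro integral_nonneg_AE AE_I2 B_nonneg) auto
  assume v: "v \<in> C1_0 \<Omega>"
  show "(\<lambda>x. u x + c * v x) \<in> C1_0 \<Omega>"
    using u v by (rule C1_0_linear_combination)
  show "grad_form u v = grad_form v u"
    by (simp add: grad_form_def B_sym_inner[of _ "grad u _"])
  assume w: "w \<in> C1_0 \<Omega>"
  have "grad_form (\<lambda>x. u x + c * v x) w = (\<integral>x. (B x *v grad u x) \<bullet> grad w x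
      + c * ((B x *v grad v x) \<bullet> grad w x) \<partial>M)"
    by (simp add: grad_form_def C1_0_linear_combination[OF u v] matrix_vector_right_distrib
        matrix_vector_mult_scaleR inner_add_left)
  then show "grad_form (\<lambda>x. u x + c * v x) w = grad_form u w + c * grad_form v w"
    using integrable_grad_form[OF u w] integrable_grad_form[OF v w]
    by (simp add: grad_form_def)
qed

lemma grad_form_le:
  assumes u: "u \<in> C1_0 \<Omega>" shows "grad_form u u \<le> \<Lambda> * X_form u u"
proof -
  have "grad_form u u \<le> (\<integral>x. \<Lambda> * (\<Sum>j\<in>UNIV. (X_deriv (X j) u x)\<^sup>2) \<partial>M)"
    unfolding grad_form_def
    by (intro integral_mono integrable_grad_form integrable_mult_right integrable_X_square u)
      (auto simp: X_deriv_eq_inner intro: elliptic_upper)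
  then show ?thesis by (simp add: X_form_self)
qed

lemma X_form_le:
  assumes u: "u \<in> C1_0 \<Omega>" shows "X_form u u \<le> \<Lambda> * grad_form u u"
proof -
  have "X_form u u \<le> (\<integral>x. \<Lambda> * ((B x *v grad u x) \<bullet> grad u x) \<partial>M)"
    unfolding X_form_self
    by (intro integral_mono integrable_grad_form integrable_mult_right integrable_X_square u)
      (auto simp: X_deriv_eq_inner intro: elliptic_lower)
  then show ?thesis by (simp add: grad_form_def)
qed

lemma abs_grad_form_le:
  assumes u: "u \<in> C1_0 \<Omega>" and v: "v \<in> C1_0 \<Omega>"
  shows "\<bar>grad_form u v\<bar> \<le> \<Lambda> * X_norm \<Omega> X u * X_norm \<Omega> X v"
proof -
  have "\<bar>grad_form u v\<bar> \<le> sqrt (grad_form u u) * sqrt (grad_form v v)"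
    by (rule G.abs_le[OF u v])
  also have "\<dots> \<le> sqrt (\<Lambda> * X_form u u) * sqrt (\<Lambda> * X_form v v)"
    using u v \<Lambda>_pos
    by (intro mult_mono real_sqrt_le_mono grad_form_le real_sqrt_ge_zero)
      (auto simp: G.nonneg X.nonneg)
  also have "\<dots> = \<Lambda> * X_norm \<Omega> X u * X_norm \<Omega> X v"
    using \<Lambda>_pos by (simp add: X_norm_eq real_sqrt_mult)
  finally show ?thesis .
qed

end

section \<open>The completion\<close>

context X_elliptic
begin

lemma X_norm_nonneg: "u \<in> C1_0 \<Omega> \<Longrightarrow> 0 \<le> X_norm \<Omega> X u"
  by (simp add: X_norm_eq X.nonneg)

lemma X_norm_triangle:
  "u \<in> C1_0 \<Omega> \<Longrightarrow> v \<in> C1_0 \<Omega> \<Longrightarrow> X_norm \<Omega> X (\<lambda>x. u x - v x) \<le> X_norm \<Omega> X u + X_norm \<Omega> X v"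
  unfolding X_norm_eq by (rule X.triangle)

lemma X_norm_triangle3:
  "u \<in> C1_0 \<Omega> \<Longrightarrow> v \<in> C1_0 \<Omega> \<Longrightarrow> w \<in> C1_0 \<Omega> \<Longrightarrow>
    X_norm \<Omega> X (\<lambda>x. u x - w x) \<le> X_norm \<Omega> X (\<lambda>x. u x - v x) + X_norm \<Omega> X (\<lambda>x. w x - v x)"
  unfolding X_norm_eq by (rule X.triangle3)

lemma X_norm_commute:
  "u \<in> C1_0 \<Omega> \<Longrightarrow> v \<in> C1_0 \<Omega> \<Longrightarrow> X_norm \<Omega> X (\<lambda>x. u x - v x) = X_norm \<Omega> X (\<lambda>x. v x - u x)"
  unfolding X_norm_eq by (simp add: X.square_diff X.sym)

lemma X_norm_zero [simp]: "X_norm \<Omega> X (\<lambda>x. 0) = 0"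
proof -
  have "grad (\<lambda>x. 0 :: real) x = 0" for x :: "real^'n"
    by (rule grad_unique) simp
  then show ?thesis by (simp add: X_norm_def X_deriv_eq_inner)
qed

lemma X_norm_le_of_diff:
  "u \<in> C1_0 \<Omega> \<Longrightarrow> v \<in> C1_0 \<Omega> \<Longrightarrow> X_norm \<Omega> X u \<le> X_norm \<Omega> X (\<lambda>x. u x - v x) + X_norm \<Omega> X v"
  using X_norm_triangle3[of u v "\<lambda>x. 0"] X_norm_triangle[of "\<lambda>x. 0" v] C1_0_zero[of \<Omega>] by simp

lemma X_Cauchy_C1_0: "\<phi> \<in> X_Cauchy \<Omega> X \<Longrightarrow> \<phi> n \<in> C1_0 \<Omega>"
  by (simp add: X_Cauchy_def)

lemma X_CauchyD:
  assumes "\<phi> \<in> X_Cauchy \<Omega> X" "e > 0"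
  obtains K where "\<And>m n. m \<ge> K \<Longrightarrow> n \<ge> K \<Longrightarrow> X_norm \<Omega> X (\<lambda>x. \<phi> m x - \<phi> n x) < e"
proof -
  have "\<exists>K. \<forall>m\<ge>K. \<forall>n\<ge>K. X_norm \<Omega> X (\<lambda>x. \<phi> m x - \<phi> n x) < e"
    using assms unfolding X_Cauchy_def by blast
  then show thesis using that by blast
qed

lemma X_Cauchy_bounded:
  assumes "\<phi> \<in> X_Cauchy \<Omega> X"
  obtains C where "C > 0" "\<And>n. X_norm \<Omega> X (\<phi> n) \<le> C"
proof -
  obtain K where K: "\<And>m n. m \<ge> K \<Longrightarrow> n \<ge> K \<Longrightarrow> X_norm \<Omega> X (\<lambda>x. \<phi> m x - \<phi> n x) < 1"
    using X_CauchyD[OF assms, of 1] by auto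
  define C where "C = 1 + (\<Sum>n\<le>K. X_norm \<Omega> X (\<phi> n))"
  have nn: "0 \<le> X_norm \<Omega> X (\<phi> n)" for n
    by (intro X_norm_nonneg X_Cauchy_C1_0 assms)
  have small: "X_norm \<Omega> X (\<phi> n) \<le> C - 1" if "n \<le> K" for n
    using that by (auto simp: C_def intro!: member_le_sum nn)
  have "X_norm \<Omega> X (\<phi> n) \<le> C" for n
  proof (cases "n \<le> K")
    case True
    then show ?thesis using small[of n] by simp
  next
    case False
    then show ?thesis
      using X_norm_le_of_diff[OF X_Cauchy_C1_0[OF assms] X_Cauchy_C1_0[OF assms], of n K]
        K[of n K] small[of K] by simp
  qed
  moreover have "C > 0" using small[of K] nn[of K] by (simp add: C_def sum_nonneg nn add_pos_nonneg)
  ultimately show thesis using that by blast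
qed

lemma X_Cauchy_diff:
  assumes "\<phi> \<in> X_Cauchy \<Omega> X" "\<psi> \<in> X_Cauchy \<Omega> X"
  shows "(\<lambda>n x. \<phi> n x - \<psi> n x) \<in> X_Cauchy \<Omega> X"
  unfolding X_Cauchy_def
proof (intro CollectI conjI allI impI)
  have C: "\<phi> n \<in> C1_0 \<Omega>" "\<psi> n \<in> C1_0 \<Omega>" for n using assms X_Cauchy_C1_0 by auto
  show "(\<lambda>x. \<phi> n x - \<psi> n x) \<in> C1_0 \<Omega>" for n
    using C by (rule C1_0_diff)
  fix e :: real assume "e > 0"
  then have "e / 2 > 0" by simp
  from X_CauchyD[OF assms(1) this] X_CauchyD[OF assms(2) this]
  obtain K L where K: "\<And>m n. m \<ge> K \<Longrightarrow> n \<ge> K \<Longrightarrow> X_norm \<Omega> X (\<lambda>x. \<phi> m x - \<phi> n x) < e / 2"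
    and L: "\<And>m n. m \<ge> L \<Longrightarrow> n \<ge> L \<Longrightarrow> X_norm \<Omega> X (\<lambda>x. \<psi> m x - \<psi> n x) < e / 2"
    by metis
  have "X_norm \<Omega> X (\<lambda>x. \<phi> m x - \<psi> m x - (\<phi> n x - \<psi> n x)) < e" if "m \<ge> max K L" "n \<ge> max K L" for m n
  proof -
    have "(\<lambda>x. \<phi> m x - \<psi> m x - (\<phi> n x - \<psi> n x)) = (\<lambda>x. (\<phi> m x - \<phi> n x) - (\<psi> m x - \<psi> n x))"
      by auto
    then show ?thesis
      using X_norm_triangle[OF C1_0_diff(1)[OF C(1)[of m] C(1)[of n]] C1_0_diff(1)[OF C(2)[of m] C(2)[of n]]]
        K[of m n] L[of m n] that by simp
  qed
  then show "\<exists>M. \<forall>m\<ge>M. \<forall>n\<ge>M. X_norm \<Omega> X (\<lambda>x. \<phi> m x - \<psi> m x - (\<phi> n x - \<psi> n x)) < e"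
    by blast
qed

lemma X_Cauchy_const: "u \<in> C1_0 \<Omega> \<Longrightarrow> (\<lambda>n. u) \<in> X_Cauchy \<Omega> X"
  by (simp add: X_Cauchy_def)

lemma equiv_X_equiv: "equiv (X_Cauchy \<Omega> X) (X_equiv \<Omega> X)"
proof (rule equivI)
  show "X_equiv \<Omega> X \<subseteq> X_Cauchy \<Omega> X \<times> X_Cauchy \<Omega> X"
    by (auto simp: X_equiv_def)
  show "refl_on (X_Cauchy \<Omega> X) (X_equiv \<Omega> X)"
    by (rule refl_onI) (auto simp: X_equiv_def)
  show "sym (X_equiv \<Omega> X)"
  proof (rule symI)
    fix \<phi> \<psi> assume a: "(\<phi>, \<psi>) \<in> X_equiv \<Omega> X"
    then have "X_norm \<Omega> X (\<lambda>x. \<psi> n x - \<phi> n x) = X_norm \<Omega> X (\<lambda>x. \<phi> n x - \<psi> n x)" for n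
      by (intro X_norm_commute X_Cauchy_C1_0) (auto simp: X_equiv_def)
    then show "(\<psi>, \<phi>) \<in> X_equiv \<Omega> X" using a by (simp add: X_equiv_def)
  qed
  show "trans (X_equiv \<Omega> X)"
  proof (rule transI)
    fix \<phi> \<psi> \<theta> assume a: "(\<phi>, \<psi>) \<in> X_equiv \<Omega> X" "(\<psi>, \<theta>) \<in> X_equiv \<Omega> X"
    then have C: "\<phi> \<in> X_Cauchy \<Omega> X" "\<psi> \<in> X_Cauchy \<Omega> X" "\<theta> \<in> X_Cauchy \<Omega> X"
      and lim: "(\<lambda>n. X_norm \<Omega> X (\<lambda>x. \<phi> n x - \<psi> n x) + X_norm \<Omega> X (\<lambda>x. \<psi> n x - \<theta> n x)) \<longlonglongrightarrow> 0"
      by (auto simp: X_equiv_def intro: tendsto_add_zero)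
    note C' = C[THEN X_Cauchy_C1_0]
    have "norm (X_norm \<Omega> X (\<lambda>x. \<phi> n x - \<theta> n x))
        \<le> X_norm \<Omega> X (\<lambda>x. \<phi> n x - \<psi> n x) + X_norm \<Omega> X (\<lambda>x. \<psi> n x - \<theta> n x)" for n
      using X_norm_triangle3[OF C'(1)[of n] C'(2)[of n] C'(3)[of n]] X_norm_commute[OF C'(2)[of n] C'(3)[of n]]
        X_norm_nonneg[OF C1_0_diff(1)[OF C'(1)[of n] C'(3)[of n]]] by simp
    then have "(\<lambda>n. X_norm \<Omega> X (\<lambda>x. \<phi> n x - \<theta> n x)) \<longlonglongrightarrow> 0"
      by (intro Lim_null_comparison[OF _ lim]) simp
    then show "(\<phi>, \<theta>) \<in> X_equiv \<Omega> X" using C by (simp add: X_equiv_def)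
  qed
qed

definition HX_class :: "(nat \<Rightarrow> real^'n \<Rightarrow> real) \<Rightarrow> (nat \<Rightarrow> real^'n \<Rightarrow> real) set" where
  "HX_class \<phi> = X_equiv \<Omega> X `` {\<phi>}"

lemma HX_class_in_HX: "\<phi> \<in> X_Cauchy \<Omega> X \<Longrightarrow> HX_class \<phi> \<in> HX \<Omega> X"
  by (simp add: HX_class_def HX_def quotientI)

lemma mem_HX_class: "\<phi> \<in> X_Cauchy \<Omega> X \<Longrightarrow> \<phi> \<in> HX_class \<phi>"
  unfolding HX_class_def using equiv_X_equiv by (rule equiv_class_self)

lemma HX_nonempty:
  assumes "U \<in> HX \<Omega> X" obtains \<phi> where "\<phi> \<in> U"
  using in_quotient_imp_non_empty[OF equiv_X_equiv] assms unfolding HX_def by blast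

lemma HX_memD: "U \<in> HX \<Omega> X \<Longrightarrow> \<phi> \<in> U \<Longrightarrow> \<phi> \<in> X_Cauchy \<Omega> X"
  using in_quotient_imp_subset[OF equiv_X_equiv] unfolding HX_def by blast

lemma HX_mem_equiv:
  assumes "U \<in> HX \<Omega> X" "\<phi> \<in> U" "\<psi> \<in> U"
  shows "(\<lambda>n. X_norm \<Omega> X (\<lambda>x. \<phi> n x - \<psi> n x)) \<longlonglongrightarrow> 0"
  using in_quotient_imp_in_rel[OF equiv_X_equiv, of U \<phi> \<psi>] assms
  by (simp add: HX_def X_equiv_def)

lemma X_norm_diff_le:
  assumes u: "u \<in> C1_0 \<Omega>" and v: "v \<in> C1_0 \<Omega>"
  shows "\<bar>X_norm \<Omega> X u - X_norm \<Omega> X v\<bar> \<le> X_norm \<Omega> X (\<lambda>x. u x - v x)"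
  using X_norm_le_of_diff[OF u v] X_norm_le_of_diff[OF v u] X_norm_commute[OF u v] by linarith

lemma X_norm_tendsto_HX_norm:
  assumes U: "U \<in> HX \<Omega> X" and \<phi>: "\<phi> \<in> U"
  shows "(\<lambda>n. X_norm \<Omega> X (\<phi> n)) \<longlonglongrightarrow> HX_norm \<Omega> X U"
proof -
  note C = HX_memD[OF U]
  have "Cauchy (\<lambda>n. X_norm \<Omega> X (\<phi> n))"
    unfolding Cauchy_altdef2 
  proof (intro allI impI)
    fix e :: real assume "e > 0"
    then obtain K where K: "\<And>m n. m \<ge> K \<Longrightarrow> n \<ge> K \<Longrightarrow> X_norm \<Omega> X (\<lambda>x. \<phi> m x - \<phi> n x) < e"
      using X_CauchyD[OF C[OF \<phi>]] by blast
    have "dist (X_norm \<Omega> X (\<phi> n)) (X_norm \<Omega> X (\<phi> K)) < e" if "n \<ge> K" for n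
      using X_norm_diff_le[OF X_Cauchy_C1_0[OF C[OF \<phi>]] X_Cauchy_C1_0[OF C[OF \<phi>]], of n K] K[of n K] that
      by (simp add: dist_real_def)
    then show "\<exists>N. \<forall>n\<ge>N. dist (X_norm \<Omega> X (\<phi> n)) (X_norm \<Omega> X (\<phi> N)) < e" by blast
  qed
  then obtain r where r: "(\<lambda>n. X_norm \<Omega> X (\<phi> n)) \<longlonglongrightarrow> r"
    using Cauchy_convergent convergent_def by blast
  have all: "(\<lambda>n. X_norm \<Omega> X (\<psi> n)) \<longlonglongrightarrow> r" if \<psi>: "\<psi> \<in> U" for \<psi>
  proof -
    have "(\<lambda>n. X_norm \<Omega> X (\<phi> n) - X_norm \<Omega> X (\<psi> n)) \<longlonglongrightarrow> 0"
      by (rule Lim_null_comparison[OF _ HX_mem_equiv[OF U \<phi> \<psi>]])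
        (simp add: X_norm_diff_le X_Cauchy_C1_0 C \<phi> \<psi>)
    from tendsto_diff[OF r this] show ?thesis by simp
  qed
  have "HX_norm \<Omega> X U = r"
    unfolding HX_norm_def using all \<phi> by (intro the_equality) (auto intro: LIMSEQ_unique)
  then show ?thesis using r by simp
qed

lemma grad_form_diff_le:
  assumes u: "u \<in> C1_0 \<Omega>" and u': "u' \<in> C1_0 \<Omega>" and v: "v \<in> C1_0 \<Omega>" and v': "v' \<in> C1_0 \<Omega>"
  shows "\<bar>grad_form u v - grad_form u' v'\<bar>
    \<le> \<Lambda> * X_norm \<Omega> X (\<lambda>x. u x - u' x) * X_norm \<Omega> X v + \<Lambda> * X_norm \<Omega> X u' * X_norm \<Omega> X (\<lambda>x. v x - v' x)"
proof -
  have "grad_form u v - grad_form u' v'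
      = grad_form (\<lambda>x. u x - u' x) v + grad_form u' (\<lambda>x. v x - v' x)"
    using assms by (simp add: G.diff_left G.diff_right)
  then show ?thesis
    using abs_grad_form_le[OF C1_0_diff(1)[OF u u'] v] abs_grad_form_le[OF u' C1_0_diff(1)[OF v v']]
    by linarith
qed

text \<open>The continuity estimate \<open>grad_form_diff_le\<close> shows both that the values along two
  representatives form a Cauchy sequence and that the limit does not depend on the representatives,
  which is what the definite description in \<open>HX_form\<close> needs.\<close>

lemma grad_form_tendsto_HX_form:
  assumes U: "U \<in> HX \<Omega> X" and V: "V \<in> HX \<Omega> X" and \<phi>: "\<phi> \<in> U" and \<psi>: "\<psi> \<in> V"
  shows "(\<lambda>n. grad_form (\<phi> n) (\<psi> n)) \<longlonglongrightarrow> HX_form \<Omega> B U V"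
proof -
  note C = HX_memD[OF U] HX_memD[OF V]
  note C1 = X_Cauchy_C1_0[OF C(1)] X_Cauchy_C1_0[OF C(2)]
  have "Cauchy (\<lambda>n. grad_form (\<phi> n) (\<psi> n))"
    unfolding Cauchy_altdef2 
  proof (intro allI impI)
    fix e :: real assume e: "e > 0"
    obtain D where D: "D > 0" "\<And>n. X_norm \<Omega> X (\<phi> n) \<le> D" using X_Cauchy_bounded[OF C(1)[OF \<phi>]] by blast
    obtain F where F: "F > 0" "\<And>n. X_norm \<Omega> X (\<psi> n) \<le> F" using X_Cauchy_bounded[OF C(2)[OF \<psi>]] by blast
    have "e / (2 * \<Lambda> * F) > 0" "e / (2 * \<Lambda> * D) > 0" using e D F \<Lambda>_pos by auto
    from X_CauchyD[OF C(1)[OF \<phi>] this(1)] X_CauchyD[OF C(2)[OF \<psi>] this(2)]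
    obtain K L where K: "\<And>m n. m \<ge> K \<Longrightarrow> n \<ge> K \<Longrightarrow> X_norm \<Omega> X (\<lambda>x. \<phi> m x - \<phi> n x) < e / (2 * \<Lambda> * F)"
      and L: "\<And>m n. m \<ge> L \<Longrightarrow> n \<ge> L \<Longrightarrow> X_norm \<Omega> X (\<lambda>x. \<psi> m x - \<psi> n x) < e / (2 * \<Lambda> * D)"
      by metis
    let ?N = "max K L"
    have "dist (grad_form (\<phi> n) (\<psi> n)) (grad_form (\<phi> ?N) (\<psi> ?N)) < e" if n: "n \<ge> ?N" for n
    proof -
      have "\<Lambda> * X_norm \<Omega> X (\<lambda>x. \<phi> n x - \<phi> ?N x) * X_norm \<Omega> X (\<psi> n)
          \<le> \<Lambda> * X_norm \<Omega> X (\<lambda>x. \<phi> n x - \<phi> ?N x) * F"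
        using F \<Lambda>_pos by (intro mult_left_mono mult_nonneg_nonneg X_norm_nonneg C1_0_diff C1 \<phi>) auto
      also have "\<dots> < \<Lambda> * (e / (2 * \<Lambda> * F)) * F"
        using K[of n ?N] n F(1) \<Lambda>_pos by (intro mult_strict_right_mono mult_strict_left_mono) auto
      also have "\<dots> = e / 2" using F(1) \<Lambda>_pos by simp
      finally have 1: "\<Lambda> * X_norm \<Omega> X (\<lambda>x. \<phi> n x - \<phi> ?N x) * X_norm \<Omega> X (\<psi> n) < e / 2" .
      have "\<Lambda> * X_norm \<Omega> X (\<phi> ?N) * X_norm \<Omega> X (\<lambda>x. \<psi> n x - \<psi> ?N x)
          \<le> \<Lambda> * D * X_norm \<Omega> X (\<lambda>x. \<psi> n x - \<psi> ?N x)"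
        using D \<Lambda>_pos by (intro mult_right_mono mult_left_mono X_norm_nonneg C1_0_diff C1 \<psi>) auto
      also have "\<dots> < \<Lambda> * D * (e / (2 * \<Lambda> * D))"
        using L[of n ?N] n D(1) \<Lambda>_pos by (intro mult_strict_left_mono) auto
      also have "\<dots> = e / 2" using D(1) \<Lambda>_pos by simp
      finally show ?thesis
        using 1 grad_form_diff_le[OF C1(1)[OF \<phi>, of n] C1(1)[OF \<phi>, of ?N] C1(2)[OF \<psi>, of n] C1(2)[OF \<psi>, of ?N]]
        unfolding dist_real_def by linarith
    qed
    then show "\<exists>N. \<forall>n\<ge>N. dist (grad_form (\<phi> n) (\<psi> n)) (grad_form (\<phi> N) (\<psi> N)) < e" by blast
  qed
  then obtain r where r: "(\<lambda>n. grad_form (\<phi> n) (\<psi> n)) \<longlonglongrightarrow> r"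
    using Cauchy_convergent convergent_def by blast
  have all: "(\<lambda>n. grad_form (\<phi>' n) (\<psi>' n)) \<longlonglongrightarrow> r" if \<phi>': "\<phi>' \<in> U" and \<psi>': "\<psi>' \<in> V" for \<phi>' \<psi>'
  proof -
    obtain D where D: "D > 0" "\<And>n. X_norm \<Omega> X (\<phi>' n) \<le> D" using X_Cauchy_bounded[OF C(1)[OF \<phi>']] by blast
    obtain F where F: "F > 0" "\<And>n. X_norm \<Omega> X (\<psi> n) \<le> F" using X_Cauchy_bounded[OF C(2)[OF \<psi>]] by blast
    have lim: "(\<lambda>n. \<Lambda> * X_norm \<Omega> X (\<lambda>x. \<phi> n x - \<phi>' n x) * F + \<Lambda> * D * X_norm \<Omega> X (\<lambda>x. \<psi> n x - \<psi>' n x))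
        \<longlonglongrightarrow> \<Lambda> * 0 * F + \<Lambda> * D * 0"
      by (intro tendsto_intros HX_mem_equiv[OF U \<phi> \<phi>'] HX_mem_equiv[OF V \<psi> \<psi>'])
    have bound: "norm (grad_form (\<phi> n) (\<psi> n) - grad_form (\<phi>' n) (\<psi>' n))
        \<le> \<Lambda> * X_norm \<Omega> X (\<lambda>x. \<phi> n x - \<phi>' n x) * F + \<Lambda> * D * X_norm \<Omega> X (\<lambda>x. \<psi> n x - \<psi>' n x)" for n
    proof -
      have "\<Lambda> * X_norm \<Omega> X (\<lambda>x. \<phi> n x - \<phi>' n x) * X_norm \<Omega> X (\<psi> n)
          \<le> \<Lambda> * X_norm \<Omega> X (\<lambda>x. \<phi> n x - \<phi>' n x) * F"
        using F \<Lambda>_pos by (intro mult_left_mono mult_nonneg_nonneg X_norm_nonneg C1_0_diff C1 \<phi> \<phi>') auto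
      moreover have "\<Lambda> * X_norm \<Omega> X (\<phi>' n) * X_norm \<Omega> X (\<lambda>x. \<psi> n x - \<psi>' n x)
          \<le> \<Lambda> * D * X_norm \<Omega> X (\<lambda>x. \<psi> n x - \<psi>' n x)"
        using D \<Lambda>_pos by (intro mult_right_mono mult_left_mono X_norm_nonneg C1_0_diff C1 \<psi> \<psi>') auto
      ultimately show ?thesis
        using grad_form_diff_le[OF C1(1)[OF \<phi>, of n] C1(1)[OF \<phi>', of n] C1(2)[OF \<psi>, of n] C1(2)[OF \<psi>', of n]]
        unfolding real_norm_def by linarith
    qed
    have "(\<lambda>n. grad_form (\<phi> n) (\<psi> n) - grad_form (\<phi>' n) (\<psi>' n)) \<longlonglongrightarrow> 0"
      by (rule Lim_null_comparison[OF always_eventually[OF allI[OF bound]]]) (use lim in simp)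
    from tendsto_diff[OF r this] show ?thesis by simp
  qed
  have "HX_form \<Omega> B U V = r"
    unfolding HX_form_def grad_form_def[symmetric]
  proof (rule the_equality)
    show "\<forall>\<phi>\<in>U. \<forall>\<psi>\<in>V. (\<lambda>n. grad_form (\<phi> n) (\<psi> n)) \<longlonglongrightarrow> r" using all by blast
    show "s = r" if "\<forall>\<phi>\<in>U. \<forall>\<psi>\<in>V. (\<lambda>n. grad_form (\<phi> n) (\<psi> n)) \<longlonglongrightarrow> s" for s
      using that \<phi> \<psi> r LIMSEQ_unique by blast
  qed
  then show ?thesis using r by simp
qed

end

section \<open>Limits in the space of integrable functions\<close>

lemma L1_limit_unique:
  fixes g h :: "'a \<Rightarrow> real"
  assumes "\<And>n. integrable M (\<phi> n)" "integrable M g" "integrable M h"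
    and "(\<lambda>n. \<integral>x. \<bar>\<phi> n x - g x\<bar> \<partial>M) \<longlonglongrightarrow> 0" "(\<lambda>n. \<integral>x. \<bar>\<phi> n x - h x\<bar> \<partial>M) \<longlonglongrightarrow> 0"
  shows "AE x in M. g x = h x"
proof -
  have "(\<integral>x. \<bar>g x - h x\<bar> \<partial>M) \<le> (\<integral>x. \<bar>\<phi> n x - g x\<bar> \<partial>M) + (\<integral>x. \<bar>\<phi> n x - h x\<bar> \<partial>M)" for n
  proof -
    have "(\<integral>x. \<bar>g x - h x\<bar> \<partial>M) \<le> (\<integral>x. \<bar>\<phi> n x - g x\<bar> + \<bar>\<phi> n x - h x\<bar> \<partial>M)"
      using assms(1-3) by (intro integral_mono Bochner_Integration.integrable_add integrable_abs
          Bochner_Integration.integrable_diff) auto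
    then show ?thesis
      using assms(1-3) by simp
  qed
  then have "(\<integral>x. \<bar>g x - h x\<bar> \<partial>M) \<le> 0"
    using tendsto_add[OF assms(4,5)] by (intro LIMSEQ_le_const) auto
  moreover have "0 \<le> (\<integral>x. \<bar>g x - h x\<bar> \<partial>M)"
    by (intro integral_nonneg_AE AE_I2) simp
  ultimately have "(\<integral>x. \<bar>g x - h x\<bar> \<partial>M) = 0" by simp
  then have "AE x in M. \<bar>g x - h x\<bar> = 0"
    using assms(2,3) by (subst (asm) integral_nonneg_eq_0_iff_AE) auto
  then show ?thesis by eventually_elim simp
qed

lemma L1_Cauchy_of_limit:
  fixes g :: "'a \<Rightarrow> real"
  assumes int: "\<And>n. integrable M (\<phi> n)" "integrable M g"
    and lim: "(\<lambda>n. \<integral>x. \<bar>\<phi> n x - g x\<bar> \<partial>M) \<longlonglongrightarrow> 0" and e: "e > 0"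
  obtains K where "\<And>m n. m \<ge> K \<Longrightarrow> n \<ge> K \<Longrightarrow> (\<integral>x. \<bar>\<phi> m x - \<phi> n x\<bar> \<partial>M) < e"
proof -
  have "eventually (\<lambda>n. (\<integral>x. \<bar>\<phi> n x - g x\<bar> \<partial>M) < e / 2) sequentially"
    using lim e by (intro order_tendstoD) auto
  then obtain K where K: "\<And>n. n \<ge> K \<Longrightarrow> (\<integral>x. \<bar>\<phi> n x - g x\<bar> \<partial>M) < e / 2"
    by (auto simp: eventually_sequentially)
  have "(\<integral>x. \<bar>\<phi> m x - \<phi> n x\<bar> \<partial>M) < e" if "m \<ge> K" "n \<ge> K" for m n
  proof -
    have "(\<integral>x. \<bar>\<phi> m x - \<phi> n x\<bar> \<partial>M) \<le> (\<integral>x. \<bar>\<phi> m x - g x\<bar> + \<bar>\<phi> n x - g x\<bar> \<partial>M)"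
      using int by (intro integral_mono Bochner_Integration.integrable_add integrable_abs
          Bochner_Integration.integrable_diff) auto
    also have "\<dots> = (\<integral>x. \<bar>\<phi> m x - g x\<bar> \<partial>M) + (\<integral>x. \<bar>\<phi> n x - g x\<bar> \<partial>M)"
      using int by simp
    finally show ?thesis using K[OF that(1)] K[OF that(2)] by simp
  qed
  then show thesis using that by blast
qed

lemma L1_limit_AE_subseq:
  fixes g :: "'a \<Rightarrow> real"
  assumes int: "\<And>n. integrable M (\<phi> n)" "integrable M g"
    and lim: "(\<lambda>n. \<integral>x. \<bar>\<phi> n x - g x\<bar> \<partial>M) \<longlonglongrightarrow> 0"
  obtains r where "strict_mono r" "AE x in M. (\<lambda>n. \<phi> (r n) x) \<longlonglongrightarrow> g x"
proof -
  have "\<exists>r::nat\<Rightarrow>nat. strict_mono r \<and> (AE x in M. (\<lambda>n. \<phi> (r n) x - g x) \<longlonglongrightarrow> 0)"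
    using int lim by (intro tendsto_L1_AE_subseq Bochner_Integration.integrable_diff) auto
  then show thesis using that by (auto simp: LIM_zero_iff)
qed

lemma integrable_mult_bounded:
  fixes f g :: "'a \<Rightarrow> real"
  assumes "integrable M f" "g \<in> borel_measurable M" "AE x in M. \<bar>g x\<bar> \<le> K"
  shows "integrable M (\<lambda>x. f x * g x)"
proof (rule Bochner_Integration.integrable_bound)
  show "integrable M (\<lambda>x. K * \<bar>f x\<bar>)" using assms(1) by auto
  show "AE x in M. norm (f x * g x) \<le> norm (K * \<bar>f x\<bar>)"
    using assms(3)
  proof eventually_elim
    case (elim x)
    then show ?case
      using mult_right_mono[of "\<bar>g x\<bar>" "\<bar>K\<bar>" "\<bar>f x\<bar>"] by (simp add: abs_mult mult.commute)
  qed
qed (use assms in auto)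

text \<open>An \<open>L\<^sup>1\<close> Cauchy sequence converges in \<open>L\<^sup>1\<close> to its almost everywhere limit: Fatou's lemma
  along the subsequence bounds the distance of \<open>h m\<close> from \<open>g\<close> by the Cauchy estimate.\<close>

lemma L1_Cauchy_AE_limit:
  fixes h :: "nat \<Rightarrow> 'a \<Rightarrow> real"
  assumes int: "\<And>n. integrable M (h n)" and g [measurable]: "g \<in> borel_measurable M"
    and r: "strict_mono r" "AE x in M. (\<lambda>n. h (r n) x) \<longlonglongrightarrow> g x"
    and cauchy: "\<And>e. e > 0 \<Longrightarrow> \<exists>K. \<forall>m\<ge>K. \<forall>n\<ge>K. (\<integral>x. \<bar>h m x - h n x\<bar> \<partial>M) < e"
  shows "integrable M g" and "(\<lambda>n. \<integral>x. \<bar>h n x - g x\<bar> \<partial>M) \<longlonglongrightarrow> 0"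
proof -
  have [measurable]: "h n \<in> borel_measurable M" for n using int by auto
  have close: "\<exists>K. \<forall>m\<ge>K. (\<integral>\<^sup>+x. ennreal \<bar>h m x - g x\<bar> \<partial>M) \<le> ennreal e" if e: "e > 0" for e
  proof -
    obtain K where K: "\<And>m n. m \<ge> K \<Longrightarrow> n \<ge> K \<Longrightarrow> (\<integral>x. \<bar>h m x - h n x\<bar> \<partial>M) < e"
      using cauchy[OF e] by blast
    have "(\<integral>\<^sup>+x. ennreal \<bar>h m x - g x\<bar> \<partial>M) \<le> ennreal e" if m: "m \<ge> K" for m
    proof -
      have "AE x in M. ennreal \<bar>h m x - g x\<bar> = liminf (\<lambda>n. ennreal \<bar>h m x - h (r n) x\<bar>)"
        using r(2)
      proof eventually_elim
        case (elim x)
        then have "(\<lambda>n. ennreal \<bar>h m x - h (r n) x\<bar>) \<longlonglongrightarrow> ennreal \<bar>h m x - g x\<bar>"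
          by (intro tendsto_intros)
        then show ?case by (intro lim_imp_Liminf[symmetric]) auto
      qed
      then have "(\<integral>\<^sup>+x. ennreal \<bar>h m x - g x\<bar> \<partial>M) = (\<integral>\<^sup>+x. liminf (\<lambda>n. ennreal \<bar>h m x - h (r n) x\<bar>) \<partial>M)"
        by (rule nn_integral_cong_AE)
      also have "\<dots> \<le> liminf (\<lambda>n. \<integral>\<^sup>+x. ennreal \<bar>h m x - h (r n) x\<bar> \<partial>M)"
        by (rule nn_integral_liminf) simp
      also have "\<dots> \<le> ennreal e"
      proof (rule Liminf_le)
        show "\<forall>\<^sub>F n in sequentially. (\<integral>\<^sup>+x. ennreal \<bar>h m x - h (r n) x\<bar> \<partial>M) \<le> ennreal e"
          using eventually_ge_at_top[of K]
        proof eventually_elim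
          case (elim n)
          have "(\<integral>\<^sup>+x. ennreal \<bar>h m x - h (r n) x\<bar> \<partial>M) = ennreal (\<integral>x. \<bar>h m x - h (r n) x\<bar> \<partial>M)"
            using int by (intro nn_integral_eq_integral) auto
          moreover have "r n \<ge> K" using elim seq_suble[OF r(1), of n] by simp
          ultimately show ?case using K[OF m, of "r n"] by (simp add: ennreal_leI)
        qed
      qed simp
      finally show ?thesis .
    qed
    then show ?thesis by blast
  qed
  have int_diff: "\<exists>K. \<forall>m\<ge>K. integrable M (\<lambda>x. h m x - g x) \<and> (\<integral>x. \<bar>h m x - g x\<bar> \<partial>M) \<le> e" if e: "e > 0" for e
  proof -
    obtain K where K: "\<And>m. m \<ge> K \<Longrightarrow> (\<integral>\<^sup>+x. ennreal \<bar>h m x - g x\<bar> \<partial>M) \<le> ennreal e"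
      using close[OF e] by blast
    have "integrable M (\<lambda>x. h m x - g x) \<and> (\<integral>x. \<bar>h m x - g x\<bar> \<partial>M) \<le> e" if "m \<ge> K" for m
    proof
      show "integrable M (\<lambda>x. h m x - g x)"
        using K[OF that] by (intro integrableI_bounded) (auto intro: le_less_trans)
      then have "(\<integral>\<^sup>+x. ennreal \<bar>h m x - g x\<bar> \<partial>M) = ennreal (\<integral>x. \<bar>h m x - g x\<bar> \<partial>M)"
        by (intro nn_integral_eq_integral) auto
      then show "(\<integral>x. \<bar>h m x - g x\<bar> \<partial>M) \<le> e"
        using K[OF that] e by simp
    qed
    then show ?thesis by blast
  qed
  then obtain m where "integrable M (\<lambda>x. h m x - g x)" using zero_less_one by blast
  then have "integrable M (\<lambda>x. h m x - (h m x - g x))"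
    by (rule Bochner_Integration.integrable_diff[OF int])
  then show "integrable M g" by simp
  show "(\<lambda>n. \<integral>x. \<bar>h n x - g x\<bar> \<partial>M) \<longlonglongrightarrow> 0"
  proof (rule LIMSEQ_I)
    fix e :: real assume "e > 0"
    then obtain K where "\<forall>m\<ge>K. (\<integral>x. \<bar>h m x - g x\<bar> \<partial>M) \<le> e / 2"
      using int_diff[of "e / 2"] by auto
    moreover have "0 \<le> (\<integral>x. \<bar>h m x - g x\<bar> \<partial>M)" for m by simp
    ultimately show "\<exists>K. \<forall>n\<ge>K. norm ((\<integral>x. \<bar>h n x - g x\<bar> \<partial>M) - 0) < e"
      using \<open>e > 0\<close> by (intro exI[of _ K]) force
  qed
qed

text \<open>The pointwise inequality is \<open>\<bar>h\<bar> \<le> e + h\<^sup>2 / e\<close>, integrated against \<open>a\<close>. With \<open>e\<close> small, it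
  turns smallness in weighted \<open>L\<^sup>2\<close> into smallness in weighted \<open>L\<^sup>1\<close>.\<close>

lemma weighted_L1_le:
  fixes a h :: "'a \<Rightarrow> real"
  assumes a: "integrable M a" "AE x in M. a x \<ge> 0" and i: "integrable M (\<lambda>x. a x * h x)"
    and i2: "integrable M (\<lambda>x. a x * (h x)\<^sup>2)" and e: "e > 0"
  shows "(\<integral>x. \<bar>a x * h x\<bar> \<partial>M) \<le> e * (\<integral>x. a x \<partial>M) + (\<integral>x. a x * (h x)\<^sup>2 \<partial>M) / e"
proof -
  have "(\<integral>x. \<bar>a x * h x\<bar> \<partial>M) \<le> (\<integral>x. e * a x + (a x * (h x)\<^sup>2) / e \<partial>M)"
  proof (rule integral_mono_AE)
    show "integrable M (\<lambda>x. e * a x + (a x * (h x)\<^sup>2) / e)"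
      using a(1) i2 by (intro Bochner_Integration.integrable_add integrable_mult_right integrable_divide_zero) auto
    show "AE x in M. \<bar>a x * h x\<bar> \<le> e * a x + (a x * (h x)\<^sup>2) / e"
      using a(2)
    proof eventually_elim
      case (elim x)
      have "\<bar>h x\<bar> \<le> e + (h x)\<^sup>2 / e"
      proof -
        have "0 \<le> (\<bar>h x\<bar> - e)\<^sup>2 + \<bar>h x\<bar> * e" using e by simp
        then show ?thesis using e by (simp add: field_simps power2_eq_square)
      qed
      then have "a x * \<bar>h x\<bar> \<le> a x * (e + (h x)\<^sup>2 / e)"
        using elim by (rule mult_left_mono)
      then show ?case using elim by (simp add: abs_mult algebra_simps)
    qed
  qed (use i in auto)
  also have "\<dots> = e * (\<integral>x. a x \<partial>M) + (\<integral>x. a x * (h x)\<^sup>2 \<partial>M) / e"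
    using a(1) i2 by simp
  finally show ?thesis .
qed

section \<open>Truncation in the completion\<close>

context X_elliptic
begin

lemmas trunc_C1_0 = C1_0_compose[OF _ trunc_has_derivative continuous_trunc' trunc_zero]

lemma X_deriv_trunc:
  "k \<ge> 0 \<Longrightarrow> u \<in> C1_0 \<Omega> \<Longrightarrow> X_deriv Y (\<lambda>x. trunc k (u x)) x = trunc' k (u x) * X_deriv Y u x"
  by (simp add: X_deriv_eq_inner trunc_C1_0)

text \<open>The chain rule gives \<open>X(S u) = S'(u) Xu\<close>, a product of two factors that vary with \<open>u\<close>. To
  compare it at \<open>u\<close> and \<open>v\<close>, both \<open>Xu\<close> and \<open>Xv\<close> are replaced by \<open>Xw\<close> for a fixed \<open>w\<close>. The
  remaining term \<open>(S'(u) - S'(v)) Xw\<close> is small since \<open>Xw\<close> is bounded and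
  \<open>\<bar>S'(u) - S'(v)\<bar>\<^sup>2 \<le> \<bar>u - v\<bar>\<close>.\<close>

lemma X_form_trunc_diff_le:
  assumes k: "k \<ge> 0" and u: "u \<in> C1_0 \<Omega>" and v: "v \<in> C1_0 \<Omega>" and w: "w \<in> C1_0 \<Omega>"
    and C: "\<And>x. (\<Sum>j\<in>UNIV. (X_deriv (X j) w x)\<^sup>2) \<le> C"
  shows "X_form (\<lambda>x. trunc k (u x) - trunc k (v x)) (\<lambda>x. trunc k (u x) - trunc k (v x))
    \<le> 3 * X_form (\<lambda>x. u x - w x) (\<lambda>x. u x - w x) + 3 * X_form (\<lambda>x. v x - w x) (\<lambda>x. v x - w x)
      + 3 * (C * (\<integral>x. \<bar>u x - v x\<bar> \<partial>M))"
proof -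
  let ?T = "\<lambda>x. trunc k (u x) - trunc k (v x)"
  have T: "?T \<in> C1_0 \<Omega>" using k u v by (intro C1_0_diff trunc_C1_0)
  have uw: "(\<lambda>x. u x - w x) \<in> C1_0 \<Omega>" and vw: "(\<lambda>x. v x - w x) \<in> C1_0 \<Omega>"
    and uv: "(\<lambda>x. u x - v x) \<in> C1_0 \<Omega>"
    using u v w by (auto intro: C1_0_diff)
  have pt: "(\<Sum>j\<in>UNIV. (X_deriv (X j) ?T x)\<^sup>2)
    \<le> 3 * (\<Sum>j\<in>UNIV. (X_deriv (X j) (\<lambda>x. u x - w x) x)\<^sup>2)
      + 3 * (\<Sum>j\<in>UNIV. (X_deriv (X j) (\<lambda>x. v x - w x) x)\<^sup>2) + 3 * (C * \<bar>u x - v x\<bar>)" for x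
  proof -
    define s t where "s = trunc' k (u x)" and "t = trunc' k (v x)"
    have "(X_deriv (X j) ?T x)\<^sup>2
      \<le> 3 * (X_deriv (X j) (\<lambda>x. u x - w x) x)\<^sup>2 + 3 * (X_deriv (X j) (\<lambda>x. v x - w x) x)\<^sup>2
        + 3 * (\<bar>u x - v x\<bar> * (X_deriv (X j) w x)\<^sup>2)" for j
    proof -
      define a b c where "a = X_deriv (X j) u x" and "b = X_deriv (X j) v x" and "c = X_deriv (X j) w x"
      have "X_deriv (X j) ?T x = s * a - t * b"
        using k u v by (simp add: X_deriv_diff trunc_C1_0 X_deriv_trunc s_def t_def a_def b_def)
      also have "\<dots> = s * (a - c) + (- t * (b - c)) + (s - t) * c"
        by (simp add: algebra_simps)
      also have "\<dots>\<^sup>2 \<le> 3 * (s * (a - c))\<^sup>2 + 3 * (- t * (b - c))\<^sup>2 + 3 * ((s - t) * c)\<^sup>2"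
      proof -
        have "(p + q + r)\<^sup>2 \<le> 3 * p\<^sup>2 + 3 * q\<^sup>2 + 3 * r\<^sup>2" for p q r :: real
          using zero_le_power2[of "p - q"] zero_le_power2[of "q - r"] zero_le_power2[of "p - r"]
          by (simp add: power2_eq_square algebra_simps)
        then show ?thesis .
      qed
      also have "\<dots> \<le> 3 * (a - c)\<^sup>2 + 3 * (b - c)\<^sup>2 + 3 * (\<bar>u x - v x\<bar> * c\<^sup>2)"
      proof -
        have "s\<^sup>2 \<le> 1" "t\<^sup>2 \<le> 1"
          using trunc'_bounds by (auto simp: s_def t_def power_le_one_iff less_imp_le)
        then have "(s * (a - c))\<^sup>2 \<le> (a - c)\<^sup>2" "(- t * (b - c))\<^sup>2 \<le> (b - c)\<^sup>2"
          by (simp_all add: power_mult_distrib mult_left_le_one_le)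
        moreover have "((s - t) * c)\<^sup>2 \<le> \<bar>u x - v x\<bar> * c\<^sup>2"
          by (simp add: power_mult_distrib s_def t_def mult_right_mono trunc'_diff_squared)
        ultimately show ?thesis by simp
      qed
      finally show ?thesis
        using u v w by (simp add: X_deriv_diff a_def b_def c_def)
    qed
    then have "(\<Sum>j\<in>UNIV. (X_deriv (X j) ?T x)\<^sup>2)
      \<le> (\<Sum>j\<in>UNIV. 3 * (X_deriv (X j) (\<lambda>x. u x - w x) x)\<^sup>2 + 3 * (X_deriv (X j) (\<lambda>x. v x - w x) x)\<^sup>2
        + 3 * (\<bar>u x - v x\<bar> * (X_deriv (X j) w x)\<^sup>2))"
      by (intro sum_mono)
    also have "\<dots> = 3 * (\<Sum>j\<in>UNIV. (X_deriv (X j) (\<lambda>x. u x - w x) x)\<^sup>2)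
      + 3 * (\<Sum>j\<in>UNIV. (X_deriv (X j) (\<lambda>x. v x - w x) x)\<^sup>2)
      + 3 * (\<bar>u x - v x\<bar> * (\<Sum>j\<in>UNIV. (X_deriv (X j) w x)\<^sup>2))"
      by (simp add: sum.distrib sum_distrib_left)
    also have "\<dots> \<le> 3 * (\<Sum>j\<in>UNIV. (X_deriv (X j) (\<lambda>x. u x - w x) x)\<^sup>2)
      + 3 * (\<Sum>j\<in>UNIV. (X_deriv (X j) (\<lambda>x. v x - w x) x)\<^sup>2) + 3 * (C * \<bar>u x - v x\<bar>)"
      using mult_left_mono[OF C[of x], of "\<bar>u x - v x\<bar>"] by (simp add: mult.commute)
    finally show ?thesis .
  qed
  have "X_form ?T ?T \<le> (\<integral>x. 3 * (\<Sum>j\<in>UNIV. (X_deriv (X j) (\<lambda>x. u x - w x) x)\<^sup>2)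
      + 3 * (\<Sum>j\<in>UNIV. (X_deriv (X j) (\<lambda>x. v x - w x) x)\<^sup>2) + 3 * (C * \<bar>u x - v x\<bar>) \<partial>M)"
    unfolding X_form_self
    by (intro integral_mono Bochner_Integration.integrable_add integrable_mult_right integrable_abs
        integrable_X_square integrable_C1_0 T uw vw uv pt)
  also have "\<dots> = 3 * X_form (\<lambda>x. u x - w x) (\<lambda>x. u x - w x) + 3 * X_form (\<lambda>x. v x - w x) (\<lambda>x. v x - w x)
      + 3 * (C * (\<integral>x. \<bar>u x - v x\<bar> \<partial>M))"
    using integrable_X_square[OF uw] integrable_X_square[OF vw] integrable_C1_0[OF uv]
    by (simp add: X_form_self)
  finally show ?thesis .
qed

lemma X_norm_power2: "u \<in> C1_0 \<Omega> \<Longrightarrow> (X_norm \<Omega> X u)\<^sup>2 = X_form u u"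
  by (simp add: X_norm_eq X.nonneg)

lemma X_square_bounded:
  assumes "u \<in> C1_0 \<Omega>"
  obtains C where "C > 0" "\<And>x. (\<Sum>j\<in>UNIV. (X_deriv (X j) u x)\<^sup>2) \<le> C"
proof -
  have "\<forall>j. \<exists>D. \<forall>x. \<bar>X_deriv (X j) u x\<bar> \<le> D"
    using X_deriv_bounded[OF assms] by metis
  then obtain D where D: "\<And>j x. \<bar>X_deriv (X j) u x\<bar> \<le> D j" by metis
  have "(\<Sum>j\<in>UNIV. (X_deriv (X j) u x)\<^sup>2) \<le> (\<Sum>j\<in>UNIV. (D j)\<^sup>2)" for x
    by (intro sum_mono) (use D abs_le_square_iff in \<open>meson abs_ge_self order_trans\<close>)
  then show thesis
    using that[of "(\<Sum>j\<in>UNIV. (D j)\<^sup>2) + 1"] by (smt (verit) sum_nonneg zero_le_power2)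
qed

text \<open>Here \<open>w\<close> of the preceding estimate is a term of the sequence, chosen before the \<open>L\<^sup>1\<close>
  tolerance, which depends on the bound for \<open>Xw\<close>.\<close>

lemma trunc_X_Cauchy:
  assumes k: "k \<ge> 0" and \<phi>: "\<phi> \<in> X_Cauchy \<Omega> X"
    and g: "integrable M g" "(\<lambda>n. \<integral>x. \<bar>\<phi> n x - g x\<bar> \<partial>M) \<longlonglongrightarrow> 0"
  shows "(\<lambda>n x. trunc k (\<phi> n x)) \<in> X_Cauchy \<Omega> X"
  unfolding X_Cauchy_def
proof (intro CollectI conjI allI impI)
  note C1 = X_Cauchy_C1_0[OF \<phi>]
  show T: "(\<lambda>x. trunc k (\<phi> n x)) \<in> C1_0 \<Omega>" for n using k C1 by (intro trunc_C1_0)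
  fix e :: real assume e: "e > 0"
  then have e3: "e / 3 > 0" by simp
  obtain K where K: "\<And>m n. m \<ge> K \<Longrightarrow> n \<ge> K \<Longrightarrow> X_norm \<Omega> X (\<lambda>x. \<phi> m x - \<phi> n x) < e / 3"
    using X_CauchyD[OF \<phi> e3] by blast
  obtain C where C: "C > 0" "\<And>x. (\<Sum>j\<in>UNIV. (X_deriv (X j) (\<phi> K) x)\<^sup>2) \<le> C"
    using X_square_bounded[OF C1[of K]] by blast
  have "e\<^sup>2 / (9 * C) > 0" using e C by simp
  then obtain L where L: "\<And>m n. m \<ge> L \<Longrightarrow> n \<ge> L \<Longrightarrow> (\<integral>x. \<bar>\<phi> m x - \<phi> n x\<bar> \<partial>M) < e\<^sup>2 / (9 * C)"
    using L1_Cauchy_of_limit[OF integrable_C1_0[OF C1] g] by blast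
  have "X_norm \<Omega> X (\<lambda>x. trunc k (\<phi> m x) - trunc k (\<phi> n x)) < e" if mn: "m \<ge> max K L" "n \<ge> max K L" for m n
  proof -
    have sq: "X_form (\<lambda>x. \<phi> i x - \<phi> K x) (\<lambda>x. \<phi> i x - \<phi> K x) < e\<^sup>2 / 9" if "i \<ge> K" for i
    proof -
      have d: "(\<lambda>x. \<phi> i x - \<phi> K x) \<in> C1_0 \<Omega>" by (intro C1_0_diff C1)
      have "(X_norm \<Omega> X (\<lambda>x. \<phi> i x - \<phi> K x))\<^sup>2 < (e / 3)\<^sup>2"
        using K[OF that order_refl] X_norm_nonneg[OF d] by (intro power_strict_mono) auto
      then show ?thesis by (simp add: X_norm_power2[OF d] power_divide)
    qed
    have "C * (\<integral>x. \<bar>\<phi> m x - \<phi> n x\<bar> \<partial>M) < C * (e\<^sup>2 / (9 * C))"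
      using L[of m n] mn C(1) by (intro mult_strict_left_mono) auto
    then have "C * (\<integral>x. \<bar>\<phi> m x - \<phi> n x\<bar> \<partial>M) < e\<^sup>2 / 9" using C(1) by simp
    then have "X_form (\<lambda>x. trunc k (\<phi> m x) - trunc k (\<phi> n x)) (\<lambda>x. trunc k (\<phi> m x) - trunc k (\<phi> n x)) < e\<^sup>2"
      using X_form_trunc_diff_le[OF k C1[of m] C1[of n] C1[of K] C(2)] sq[of m] sq[of n] mn by linarith
    then show ?thesis
      unfolding X_norm_eq using e by (metis real_sqrt_less_mono real_sqrt_unique less_imp_le)
  qed
  then show "\<exists>M. \<forall>m\<ge>M. \<forall>n\<ge>M. X_norm \<Omega> X (\<lambda>x. trunc k (\<phi> m x) - trunc k (\<phi> n x)) < e"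
    by blast
qed

text \<open>Since \<open>0 \<le> S' \<le> 1\<close>, the factor \<open>S'\<close> that arises from \<open>B\<nabla>u\<cdot>\<nabla>(S u)\<close> dominates the factor
  \<open>S'\<^sup>2\<close> that arises from \<open>B\<nabla>(S u)\<cdot>\<nabla>(S u)\<close>.\<close>

lemma X_form_trunc_le:
  assumes k: "k \<ge> 0" and u: "u \<in> C1_0 \<Omega>"
  shows "X_form (\<lambda>x. trunc k (u x)) (\<lambda>x. trunc k (u x)) \<le> \<Lambda> * grad_form u (\<lambda>x. trunc k (u x))"
proof -
  let ?T = "\<lambda>x. trunc k (u x)"
  have T: "?T \<in> C1_0 \<Omega>" using k u by (intro trunc_C1_0)
  have "grad_form ?T ?T \<le> grad_form u ?T"
    unfolding grad_form_def
  proof (intro integral_mono integrable_grad_form u T)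
    fix x assume "x \<in> space M"
    then have x: "x \<in> \<Omega>" by simp
    have "trunc' k (u x) * trunc' k (u x) * ((B x *v grad u x) \<bullet> grad u x)
        \<le> trunc' k (u x) * ((B x *v grad u x) \<bullet> grad u x)"
      using trunc'_bounds[of k "u x"] B_nonneg[OF x, of "grad u x"]
      by (intro mult_right_mono) (auto simp: mult_le_one mult_left_le)
    then show "(B x *v grad ?T x) \<bullet> grad ?T x \<le> (B x *v grad u x) \<bullet> grad ?T x"
      using k u by (simp add: trunc_C1_0 matrix_vector_mult_scaleR mult.assoc)
  qed
  then show ?thesis
    using X_form_le[OF T] \<Lambda>_pos by (meson mult_left_mono less_imp_le order_trans)
qed

end

section \<open>Elements of the completion as integrable functions\<close>

text \<open>The embedding into \<open>L\<^sup>1\<close> is what identifies classes with functions; its injectivity allows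
  equality of classes to be tested almost everywhere.\<close>

locale X_elliptic_embedded = X_elliptic \<Omega> X B \<Lambda>
  for \<Omega> :: "(real^'n::finite) set"
    and X :: "'m::finite \<Rightarrow> real^'n \<Rightarrow> real^'n"
    and B :: "real^'n \<Rightarrow> real^'n^'n"
    and \<Lambda> :: real +
  assumes embeds: "HX_embeds \<Omega> X 1"
begin

lemma Lp_norm_1: "Lp_norm M 1 g = (\<integral>x. \<bar>g x\<bar> \<partial>M)"
  by (simp add: Lp_norm_def powr_one_gt_zero_iff)

lemma HX_represents_HX_fun: "U \<in> HX \<Omega> X \<Longrightarrow> HX_represents \<Omega> U (HX_fun \<Omega> U)"
  using embeds unfolding HX_embeds_def by blast

lemma HX_fun_integrable:
  assumes "U \<in> HX \<Omega> X" shows "integrable M (HX_fun \<Omega> U)"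
  using HX_represents_HX_fun[OF assms] by (auto simp: HX_represents_def Lp_space_def integrable_abs_iff)

lemma HX_fun_limit:
  assumes "U \<in> HX \<Omega> X" "\<phi> \<in> U"
  shows "(\<lambda>n. \<integral>x. \<bar>\<phi> n x - HX_fun \<Omega> U x\<bar> \<partial>M) \<longlonglongrightarrow> 0"
  using HX_represents_HX_fun[OF assms(1)] assms(2) by (simp add: HX_represents_def Lp_norm_1)

lemma HX_fun_unique:
  assumes "U \<in> HX \<Omega> X" "\<phi> \<in> U" "integrable M g" "(\<lambda>n. \<integral>x. \<bar>\<phi> n x - g x\<bar> \<partial>M) \<longlonglongrightarrow> 0"
  shows "AE x in M. HX_fun \<Omega> U x = g x"
  by (rule L1_limit_unique[OF _ HX_fun_integrable assms(3) HX_fun_limit assms(4)])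
    (use assms X_Cauchy_C1_0[OF HX_memD] integrable_C1_0 in auto)

lemma HX_fun_class:
  assumes "\<phi> \<in> X_Cauchy \<Omega> X" "integrable M g" "(\<lambda>n. \<integral>x. \<bar>\<phi> n x - g x\<bar> \<partial>M) \<longlonglongrightarrow> 0"
  shows "AE x in M. HX_fun \<Omega> (HX_class \<phi>) x = g x"
  by (rule HX_fun_unique[OF HX_class_in_HX mem_HX_class]) (use assms in auto)

lemma HX_eqI:
  assumes "U \<in> HX \<Omega> X" "V \<in> HX \<Omega> X" "AE x in M. HX_fun \<Omega> U x = HX_fun \<Omega> V x"
  shows "U = V"
  using embeds assms unfolding HX_embeds_def by blast

lemma HX_class_trunc:
  assumes k: "k \<ge> 0" and U: "U \<in> HX \<Omega> X" and \<phi>: "\<phi> \<in> U"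
  shows "(\<lambda>n x. trunc k (\<phi> n x)) \<in> X_Cauchy \<Omega> X"
    and "AE x in M. HX_fun \<Omega> (HX_class (\<lambda>n x. trunc k (\<phi> n x))) x = trunc k (HX_fun \<Omega> U x)"
proof -
  note C1 = X_Cauchy_C1_0[OF HX_memD[OF U \<phi>]]
  show C: "(\<lambda>n x. trunc k (\<phi> n x)) \<in> X_Cauchy \<Omega> X"
    by (rule trunc_X_Cauchy[OF k HX_memD[OF U \<phi>] HX_fun_integrable[OF U] HX_fun_limit[OF U \<phi>]])
  have cont: "continuous_on UNIV (trunc k)"
    using trunc_has_derivative[OF k] by (meson DERIV_isCont continuous_at_imp_continuous_on)
  have meas: "(\<lambda>x. trunc k (HX_fun \<Omega> U x)) \<in> borel_measurable M"
    using borel_measurable_continuous_onI[OF cont] HX_fun_integrable[OF U]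
    by (auto intro: measurable_compose)
  have int: "integrable M (\<lambda>x. trunc k (HX_fun \<Omega> U x))"
    by (rule integrable_bounded[OF meas]) (use trunc_bounded[OF k] in blast)
  have le: "(\<integral>x. \<bar>trunc k (\<phi> n x) - trunc k (HX_fun \<Omega> U x)\<bar> \<partial>M) \<le> (\<integral>x. \<bar>\<phi> n x - HX_fun \<Omega> U x\<bar> \<partial>M)" for n
    by (intro integral_mono integrable_abs Bochner_Integration.integrable_diff int
        integrable_C1_0 trunc_C1_0 k C1 HX_fun_integrable U trunc_Lipschitz)
  have "(\<lambda>n. \<integral>x. \<bar>trunc k (\<phi> n x) - trunc k (HX_fun \<Omega> U x)\<bar> \<partial>M) \<longlonglongrightarrow> 0"
    by (rule Lim_null_comparison[OF _ HX_fun_limit[OF U \<phi>]]) (use le in simp)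
  then show "AE x in M. HX_fun \<Omega> (HX_class (\<lambda>n x. trunc k (\<phi> n x))) x = trunc k (HX_fun \<Omega> U x)"
    by (rule HX_fun_class[OF C int])
qed

lemma HX_class_diff:
  assumes U: "U \<in> HX \<Omega> X" and V: "V \<in> HX \<Omega> X" and \<phi>: "\<phi> \<in> U" and \<psi>: "\<psi> \<in> V"
  shows "AE x in M. HX_fun \<Omega> (HX_class (\<lambda>n x. \<phi> n x - \<psi> n x)) x = HX_fun \<Omega> U x - HX_fun \<Omega> V x"
proof (rule HX_fun_class)
  note C1 = X_Cauchy_C1_0[OF HX_memD[OF U \<phi>]] X_Cauchy_C1_0[OF HX_memD[OF V \<psi>]]
  show "(\<lambda>n x. \<phi> n x - \<psi> n x) \<in> X_Cauchy \<Omega> X"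
    by (intro X_Cauchy_diff HX_memD[OF U \<phi>] HX_memD[OF V \<psi>])
  show "integrable M (\<lambda>x. HX_fun \<Omega> U x - HX_fun \<Omega> V x)"
    by (intro Bochner_Integration.integrable_diff HX_fun_integrable U V)
  have le: "(\<integral>x. \<bar>\<phi> n x - \<psi> n x - (HX_fun \<Omega> U x - HX_fun \<Omega> V x)\<bar> \<partial>M)
      \<le> (\<integral>x. \<bar>\<phi> n x - HX_fun \<Omega> U x\<bar> \<partial>M) + (\<integral>x. \<bar>\<psi> n x - HX_fun \<Omega> V x\<bar> \<partial>M)" for n
  proof -
    have i: "integrable M (\<lambda>x. \<bar>\<phi> n x - HX_fun \<Omega> U x\<bar>)" "integrable M (\<lambda>x. \<bar>\<psi> n x - HX_fun \<Omega> V x\<bar>)"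
      by (intro integrable_abs Bochner_Integration.integrable_diff integrable_C1_0 C1 HX_fun_integrable U V)+
    have "(\<integral>x. \<bar>\<phi> n x - \<psi> n x - (HX_fun \<Omega> U x - HX_fun \<Omega> V x)\<bar> \<partial>M)
      \<le> (\<integral>x. \<bar>\<phi> n x - HX_fun \<Omega> U x\<bar> + \<bar>\<psi> n x - HX_fun \<Omega> V x\<bar> \<partial>M)"
      by (intro integral_mono Bochner_Integration.integrable_add i integrable_abs
          Bochner_Integration.integrable_diff integrable_C1_0 C1 HX_fun_integrable U V) auto
    then show ?thesis using i by simp
  qed
  show "(\<lambda>n. \<integral>x. \<bar>\<phi> n x - \<psi> n x - (HX_fun \<Omega> U x - HX_fun \<Omega> V x)\<bar> \<partial>M) \<longlonglongrightarrow> 0"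
    by (rule Lim_null_comparison[OF _ tendsto_add_zero[OF HX_fun_limit[OF U \<phi>] HX_fun_limit[OF V \<psi>]]])
      (use le in simp)
qed

lemma HX_class_const:
  assumes "u \<in> C1_0 \<Omega>"
  shows "AE x in M. HX_fun \<Omega> (HX_class (\<lambda>n. u)) x = u x"
  by (rule HX_fun_class[OF X_Cauchy_const[OF assms] integrable_C1_0[OF assms]]) simp

lemma HX_norm_class_const:
  assumes "u \<in> C1_0 \<Omega>"
  shows "HX_norm \<Omega> X (HX_class (\<lambda>n. u)) = X_norm \<Omega> X u"
proof -
  note c = X_Cauchy_const[OF assms]
  from X_norm_tendsto_HX_norm[OF HX_class_in_HX[OF c] mem_HX_class[OF c]]
  show ?thesis by (simp add: LIMSEQ_const_iff)
qed

text \<open>Only an affine bound is asked for, so Young's inequality, applied to \<open>\<bar>R\<bar>\<close> and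
  \<open>\<bar>\<phi>\<bar> / t\<close> with a scale \<open>t\<close> that dominates the \<open>L\<^sup>q\<close> norm of \<open>\<phi>\<close>, does the work of
  Hoelder's inequality. The embedding of the completion is applied to constant sequences.\<close>

lemma dual_exponent_pairing_bound:
  assumes emb: "HX_embeds \<Omega> X q" and q: "q > 1" and conj: "1 / p + 1 / q = 1" and p: "p > 1"
    and R: "R \<in> Lp_space M p"
  obtains D where "D \<ge> 0" "\<And>\<phi>. \<phi> \<in> C1_0 \<Omega> \<Longrightarrow> integrable M (\<lambda>x. \<bar>R x\<bar> * \<bar>\<phi> x\<bar>)"
    "\<And>\<phi>. \<phi> \<in> C1_0 \<Omega> \<Longrightarrow> (\<integral>x. \<bar>R x\<bar> * \<bar>\<phi> x\<bar> \<partial>M) \<le> D * (X_norm \<Omega> X \<phi> + 1)"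
proof -
  have Lq: "HX_fun \<Omega> U \<in> Lp_space M q" if "U \<in> HX \<Omega> X" for U
    using emb that by (simp add: HX_embeds_def)
  have "\<exists>C. \<forall>U\<in>HX \<Omega> X. Lp_norm M q (HX_fun \<Omega> U) \<le> C * HX_norm \<Omega> X U"
    using emb by (simp add: HX_embeds_def)
  then obtain A0 where A0: "\<And>U. U \<in> HX \<Omega> X \<Longrightarrow> Lp_norm M q (HX_fun \<Omega> U) \<le> A0 * HX_norm \<Omega> X U"
    by metis
  define A where "A = max A0 1"
  have A: "A \<ge> 1" "A \<ge> A0" by (auto simp: A_def)
  define I where "I = (\<integral>x. \<bar>R x\<bar> powr p \<partial>M)"
  have I: "I \<ge> 0" by (simp add: I_def)
  have Rm: "R \<in> borel_measurable M" and Ri: "integrable M (\<lambda>x. \<bar>R x\<bar> powr p)"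
    using R by (auto simp: Lp_space_def)
  have main: "integrable M (\<lambda>x. \<bar>R x\<bar> * \<bar>\<phi> x\<bar>) \<and>
      (\<integral>x. \<bar>R x\<bar> * \<bar>\<phi> x\<bar> \<partial>M) \<le> (I + 1) * A * (X_norm \<Omega> X \<phi> + 1)" if \<phi>: "\<phi> \<in> C1_0 \<Omega>" for \<phi>
  proof -
    \<comment> \<open>The summand 1 keeps the scale positive when the X-norm of \<open>\<phi>\<close> vanishes.\<close>
    define t where "t = A * (X_norm \<Omega> X \<phi> + 1)"
    note nn = X_norm_nonneg[OF \<phi>]
    have t: "t > 0" unfolding t_def using A nn by (intro mult_pos_pos) auto
    note c = HX_class_in_HX[OF X_Cauchy_const[OF \<phi>]]
    have ae: "AE x in M. \<bar>HX_fun \<Omega> (HX_class (\<lambda>n. \<phi>)) x\<bar> powr q = \<bar>\<phi> x\<bar> powr q"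
      using HX_class_const[OF \<phi>] by eventually_elim simp
    have mphi: "(\<lambda>x. \<bar>\<phi> x\<bar> powr q) \<in> borel_measurable M"
      using measurable_C1_0[OF \<phi>] by measurable
    have mfun: "(\<lambda>x. \<bar>HX_fun \<Omega> (HX_class (\<lambda>n. \<phi>)) x\<bar> powr q) \<in> borel_measurable M"
      and ifun: "integrable M (\<lambda>x. \<bar>HX_fun \<Omega> (HX_class (\<lambda>n. \<phi>)) x\<bar> powr q)"
      using Lq[OF c] by (auto simp: Lp_space_def)
    have iphi: "integrable M (\<lambda>x. \<bar>\<phi> x\<bar> powr q)"
      using integrable_cong_AE[OF mfun mphi ae] ifun by simp
    have "(\<integral>x. \<bar>\<phi> x\<bar> powr q \<partial>M) powr (1 / q) = Lp_norm M q (HX_fun \<Omega> (HX_class (\<lambda>n. \<phi>)))"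
      unfolding Lp_norm_def using integral_cong_AE[OF mfun mphi ae] by simp
    also have "\<dots> \<le> A0 * X_norm \<Omega> X \<phi>"
      using A0[OF c] HX_norm_class_const[OF \<phi>] by simp
    also have "\<dots> \<le> t"
      unfolding t_def using A nn by (intro mult_mono) auto
    finally have "((\<integral>x. \<bar>\<phi> x\<bar> powr q \<partial>M) powr (1 / q)) powr q \<le> t powr q"
      using q by (intro powr_mono2) auto
    then have int_le: "(\<integral>x. \<bar>\<phi> x\<bar> powr q \<partial>M) \<le> t powr q"
      using q by (simp add: powr_powr)
    let ?Y = "\<lambda>x. t * (\<bar>R x\<bar> powr p + \<bar>\<phi> x\<bar> powr q / t powr q)"
    have young: "\<bar>R x\<bar> * \<bar>\<phi> x\<bar> \<le> ?Y x" for x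
    proof -
      have "\<bar>R x\<bar> * (\<bar>\<phi> x\<bar> / t) \<le> \<bar>R x\<bar> powr p / p + (\<bar>\<phi> x\<bar> / t) powr q / q"
        using p q conj t by (intro Youngs_inequality) auto
      also have "\<dots> \<le> \<bar>R x\<bar> powr p + \<bar>\<phi> x\<bar> powr q / t powr q"
        using p q t by (intro add_mono) (auto simp: divide_le_eq powr_divide mult_le_cancel_left1)
      finally have "t * (\<bar>R x\<bar> * (\<bar>\<phi> x\<bar> / t)) \<le> ?Y x"
        using t by (intro mult_left_mono) auto
      then show ?thesis using t by simp
    qed
    have iY: "integrable M ?Y"
      by (intro integrable_mult_right Bochner_Integration.integrable_add Ri integrable_divide_zero iphi)
    have int: "integrable M (\<lambda>x. \<bar>R x\<bar> * \<bar>\<phi> x\<bar>)"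
      by (rule Bochner_Integration.integrable_bound[OF iY])
        (use young Rm measurable_C1_0[OF \<phi>] in \<open>auto intro!: AE_I2 order_trans[OF _ abs_ge_self]\<close>)
    have "(\<integral>x. \<bar>R x\<bar> * \<bar>\<phi> x\<bar> \<partial>M) \<le> (\<integral>x. ?Y x \<partial>M)"
      by (intro integral_mono int iY young)
    also have "\<dots> = t * (I + (\<integral>x. \<bar>\<phi> x\<bar> powr q \<partial>M) / t powr q)"
      using Ri iphi by (simp add: I_def)
    also have "\<dots> \<le> t * (I + 1)"
      using int_le t by (intro mult_left_mono add_left_mono) (auto simp: divide_le_eq)
    finally show ?thesis using int by (simp add: t_def mult_ac)
  qed
  show thesis
    using main I A by (intro that[of "(I + 1) * A"]) auto
qed

section \<open>Uniqueness\<close>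

text \<open>The difference \<open>u - v\<close> of two solutions may be unbounded and hence not admissible as a test
  function, but \<open>arctan (u - v)\<close> is. Testing with it makes both terms of the equation for the
  difference nonnegative, hence zero, and the diffusion term controls the X-norm of
  \<open>arctan (u - v)\<close>.\<close>

lemma weak_solution_unique:
  assumes a: "integrable M a" "AE x in M. a x \<ge> 0"
    and U: "weak_solution \<Omega> X B a f U" and V: "weak_solution \<Omega> X B a f V"
  shows "U = V"
proof -
  have UH: "U \<in> HX \<Omega> X" and VH: "V \<in> HX \<Omega> X" using U V by (auto simp: weak_solution_def)
  let ?u = "HX_fun \<Omega> U" and ?v = "HX_fun \<Omega> V"
  have au: "integrable M (\<lambda>x. a x * ?u x)" and av: "integrable M (\<lambda>x. a x * ?v x)"
    using U V by (auto simp: weak_solution_def)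
  obtain \<phi> where \<phi>: "\<phi> \<in> U" using HX_nonempty[OF UH] .
  obtain \<psi> where \<psi>: "\<psi> \<in> V" using HX_nonempty[OF VH] .
  define w where "w = (\<lambda>n x. \<phi> n x - \<psi> n x)"
  have wC: "w \<in> X_Cauchy \<Omega> X" unfolding w_def by (intro X_Cauchy_diff HX_memD[OF UH \<phi>] HX_memD[OF VH \<psi>])
  note wH = HX_class_in_HX[OF wC]
  have ww: "AE x in M. HX_fun \<Omega> (HX_class w) x = ?u x - ?v x"
    unfolding w_def by (rule HX_class_diff[OF UH VH \<phi> \<psi>])
  define T where "T = (\<lambda>n x. trunc 0 (w n x))"
  have TC: "T \<in> X_Cauchy \<Omega> X" and TW: "AE x in M. HX_fun \<Omega> (HX_class T) x = trunc 0 (HX_fun \<Omega> (HX_class w) x)"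
    unfolding T_def by (rule HX_class_trunc[OF _ wH mem_HX_class[OF wC]]; simp)+
  note TH = HX_class_in_HX[OF TC]
  let ?z = "HX_fun \<Omega> (HX_class T)"
  have z: "AE x in M. ?z x = arctan (?u x - ?v x)"
    using ww TW by eventually_elim (simp add: trunc_0)
  have zm: "?z \<in> borel_measurable M" using HX_fun_integrable[OF TH] by auto
  have zb: "AE x in M. \<bar>?z x\<bar> \<le> 2"
    using z
  proof eventually_elim
    case (elim x)
    then show ?case using trunc_bounded[of 0 "?u x - ?v x"] by (simp add: trunc_0)
  qed
  have zinf: "?z \<in> Linf_space M" using zm zb by (auto simp: Linf_space_def)
  have test: "HX_form \<Omega> B W (HX_class T) + (\<integral>x. a x * HX_fun \<Omega> W x * ?z x \<partial>M) = (\<integral>x. f x * ?z x \<partial>M)"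
    if "weak_solution \<Omega> X B a f W" for W
    using that TH zinf by (simp add: weak_solution_def)
  have eqs: "HX_form \<Omega> B U (HX_class T) + (\<integral>x. a x * ?u x * ?z x \<partial>M)
      = HX_form \<Omega> B V (HX_class T) + (\<integral>x. a x * ?v x * ?z x \<partial>M)"
    using test[OF U] test[OF V] by simp
  have "0 \<le> (\<integral>x. a x * ?u x * ?z x - a x * ?v x * ?z x \<partial>M)"
  proof (rule integral_nonneg_AE)
    show "AE x in M. 0 \<le> a x * ?u x * ?z x - a x * ?v x * ?z x"
      using z a(2)
    proof eventually_elim
      case (elim x)
      have "0 \<le> t * arctan t" for t :: real
        by (auto simp: zero_le_mult_iff)
      then have "0 \<le> a x * ((?u x - ?v x) * arctan (?u x - ?v x))"
        by (rule mult_nonneg_nonneg[OF elim(2)])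
      then show ?case using elim(1) by (simp add: algebra_simps)
    qed
  qed
  also have "\<dots> = (\<integral>x. a x * ?u x * ?z x \<partial>M) - (\<integral>x. a x * ?v x * ?z x \<partial>M)"
    by (intro Bochner_Integration.integral_diff integrable_mult_bounded[OF au zm zb] integrable_mult_bounded[OF av zm zb])
  finally have le: "HX_form \<Omega> B U (HX_class T) - HX_form \<Omega> B V (HX_class T) \<le> 0"
    using eqs by linarith
  note C1 = X_Cauchy_C1_0[OF HX_memD[OF UH \<phi>]] X_Cauchy_C1_0[OF HX_memD[OF VH \<psi>]]
    X_Cauchy_C1_0[OF TC] X_Cauchy_C1_0[OF wC]
  note Tmem = mem_HX_class[OF TC]
  have "(\<lambda>n. grad_form (\<phi> n) (T n) - grad_form (\<psi> n) (T n))
      \<longlonglongrightarrow> HX_form \<Omega> B U (HX_class T) - HX_form \<Omega> B V (HX_class T)"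
    by (intro tendsto_diff grad_form_tendsto_HX_form UH VH TH \<phi> \<psi> Tmem)
  then have lim: "(\<lambda>n. grad_form (w n) (T n)) \<longlonglongrightarrow> HX_form \<Omega> B U (HX_class T) - HX_form \<Omega> B V (HX_class T)"
    unfolding w_def by (simp add: G.diff_left C1)
  have "(HX_norm \<Omega> X (HX_class T))\<^sup>2 \<le> \<Lambda> * (HX_form \<Omega> B U (HX_class T) - HX_form \<Omega> B V (HX_class T))"
  proof (rule LIMSEQ_le)
    show "(\<lambda>n. (X_norm \<Omega> X (T n))\<^sup>2) \<longlonglongrightarrow> (HX_norm \<Omega> X (HX_class T))\<^sup>2"
      by (intro tendsto_power X_norm_tendsto_HX_norm TH Tmem)
    show "(\<lambda>n. \<Lambda> * grad_form (w n) (T n)) \<longlonglongrightarrow> \<Lambda> * (HX_form \<Omega> B U (HX_class T) - HX_form \<Omega> B V (HX_class T))"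
      by (intro tendsto_mult_left lim)
    show "\<exists>N. \<forall>n\<ge>N. (X_norm \<Omega> X (T n))\<^sup>2 \<le> \<Lambda> * grad_form (w n) (T n)"
      using X_form_trunc_le[of 0] C1 by (auto simp: T_def X_norm_power2[OF C1(3), unfolded T_def])
  qed
  also have "\<dots> \<le> 0" using le \<Lambda>_pos by (simp add: mult_le_0_iff)
  finally have "HX_norm \<Omega> X (HX_class T) = 0" by simp
  moreover have "\<exists>C. \<forall>W\<in>HX \<Omega> X. Lp_norm M 1 (HX_fun \<Omega> W) \<le> C * HX_norm \<Omega> X W"
    using embeds by (simp add: HX_embeds_def)
  ultimately have "Lp_norm M 1 ?z \<le> 0"
    using TH by fastforce
  moreover have "0 \<le> (\<integral>x. \<bar>?z x\<bar> \<partial>M)" by simp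
  ultimately have "(\<integral>x. \<bar>?z x\<bar> \<partial>M) = 0"
    unfolding Lp_norm_1 by linarith
  then have "AE x in M. \<bar>?z x\<bar> = 0"
    using HX_fun_integrable[OF TH] by (subst (asm) integral_nonneg_eq_0_iff_AE) auto
  then have "AE x in M. ?u x = ?v x"
    using z by eventually_elim simp
  then show ?thesis by (rule HX_eqI[OF UH VH])
qed

section \<open>Existence\<close>

text \<open>Truncating a Cauchy sequence at a level that bounds its limit does not change the limit, so by
  injectivity of the embedding it does not change the class either.\<close>

lemma bounded_test_sequence:
  assumes V: "V \<in> HX \<Omega> X" and b: "HX_fun \<Omega> V \<in> Linf_space M"
  obtains \<psi> K where "\<psi> \<in> V" "\<And>n x. \<bar>\<psi> n x\<bar> \<le> K"
proof -
  obtain C where C: "AE x in M. \<bar>HX_fun \<Omega> V x\<bar> \<le> C" using b by (auto simp: Linf_space_def)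
  define k where "k = max C 0"
  have k: "k \<ge> 0" by (simp add: k_def)
  obtain \<psi> where \<psi>: "\<psi> \<in> V" using HX_nonempty[OF V] .
  let ?T = "\<lambda>n x. trunc k (\<psi> n x)"
  note T = HX_class_trunc[OF k V \<psi>]
  have "AE x in M. HX_fun \<Omega> (HX_class ?T) x = HX_fun \<Omega> V x"
    using T(2) C by eventually_elim (simp add: trunc_id k_def)
  then have "HX_class ?T = V"
    by (rule HX_eqI[OF HX_class_in_HX[OF T(1)] V])
  then have "?T \<in> V" using mem_HX_class[OF T(1)] by simp
  then show thesis using that[of ?T "k + 2"] trunc_bounded[OF k] by blast
qed

text \<open>The form \<open>E u v = \<integral> B\<nabla>u\<cdot>\<nabla>v + \<integral> a u v\<close> on \<open>C1_0 \<Omega>\<close> absorbs the right-hand side: by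
  \<open>2 * Q * a * \<bar>v\<bar> \<le> a * v\<^sup>2 + Q\<^sup>2 * a\<close> the part of \<open>f\<close> dominated by \<open>Q * a\<close> is controlled by the
  zero-order term of \<open>E\<close>, and the part dominated by \<open>R\<close> by the diffusion term. The sequence of
  \<open>approximate_Riesz\<close> is Cauchy for \<open>E\<close>, so it defines an element of the completion, and the
  products \<open>a * \<phi> n\<close> converge in \<open>L\<^sup>1\<close>. This gives the equation for test functions in \<open>C1_0 \<Omega>\<close>;
  bounded elements of the completion are reached along uniformly bounded test sequences.\<close>

lemma weak_solution_exists:
  assumes a: "integrable M a" "AE x in M. a x \<ge> 0" and f: "integrable M f"
    and R: "D \<ge> 0" "\<And>\<phi>. \<phi> \<in> C1_0 \<Omega> \<Longrightarrow> integrable M (\<lambda>x. \<bar>R x\<bar> * \<bar>\<phi> x\<bar>)"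
      "\<And>\<phi>. \<phi> \<in> C1_0 \<Omega> \<Longrightarrow> (\<integral>x. \<bar>R x\<bar> * \<bar>\<phi> x\<bar> \<partial>M) \<le> D * (X_norm \<Omega> X \<phi> + 1)"
    and f_le: "AE x in M. \<bar>f x\<bar> \<le> Q * a x + \<bar>R x\<bar>"
  obtains U where "weak_solution \<Omega> X B a f U"
proof -
  have int_mult: "integrable M (\<lambda>x. g x * v x)" if "integrable M g" "v \<in> C1_0 \<Omega>" for g v
  proof -
    obtain C where "\<And>x. \<bar>v x\<bar> \<le> C" using C1_0_bounded[OF \<open>v \<in> C1_0 \<Omega>\<close>] by metis
    then show ?thesis
      by (intro integrable_mult_bounded[OF that(1) measurable_C1_0[OF that(2)]]) auto
  qed
  have int_mult2: "integrable M (\<lambda>x. a x * u x * v x)" if "u \<in> C1_0 \<Omega>" "v \<in> C1_0 \<Omega>" for u v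
    using that by (intro int_mult a)
  define E where "E u v = grad_form u v + (\<integral>x. a x * u x * v x \<partial>M)" for u v
  define l where "l v = (\<integral>x. f x * v x \<partial>M)" for v
  interpret E: psd_form "C1_0 \<Omega>" E
  proof
    fix u v w :: "real^'n \<Rightarrow> real" and c :: real
    assume u: "u \<in> C1_0 \<Omega>"
    have "0 \<le> (\<integral>x. a x * u x * u x \<partial>M)"
      using a(2) by (intro integral_nonneg_AE) (auto simp: mult.assoc elim: eventually_mono)
    then show "0 \<le> E u u" using G.nonneg[OF u] by (simp add: E_def)
    assume v: "v \<in> C1_0 \<Omega>"
    show "(\<lambda>x. u x + c * v x) \<in> C1_0 \<Omega>" using u v by (rule G.closed)
    show "E u v = E v u" using G.sym[OF u v] by (simp add: E_def mult_ac)
    assume w: "w \<in> C1_0 \<Omega>"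
    have "(\<integral>x. a x * (u x + c * v x) * w x \<partial>M) = (\<integral>x. a x * u x * w x + c * (a x * v x * w x) \<partial>M)"
      by (simp add: algebra_simps)
    also have "\<dots> = (\<integral>x. a x * u x * w x \<partial>M) + c * (\<integral>x. a x * v x * w x \<partial>M)"
      using int_mult2 u v w by simp
    finally show "E (\<lambda>x. u x + c * v x) w = E u w + c * E v w"
      using G.linear_left[OF u v w] by (simp add: E_def algebra_simps)
  qed
  have l_lin: "l (\<lambda>x. u x + c * v x) = l u + c * l v" if u: "u \<in> C1_0 \<Omega>" and v: "v \<in> C1_0 \<Omega>" for u v c
  proof -
    have "l (\<lambda>x. u x + c * v x) = (\<integral>x. f x * u x + c * (f x * v x) \<partial>M)"
      by (simp add: l_def algebra_simps)
    then show ?thesis using int_mult[OF f u] int_mult[OF f v] by (simp add: l_def)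
  qed
  have l_bound: "2 * l v \<le> E v v + (Q\<^sup>2 * (\<integral>x. a x \<partial>M) + D\<^sup>2 * \<Lambda> + 2 * D)" if v: "v \<in> C1_0 \<Omega>" for v
  proof -
    have "2 * l v = (\<integral>x. 2 * (f x * v x) \<partial>M)" by (simp add: l_def)
    also have "\<dots> \<le> (\<integral>x. a x * v x * v x + Q\<^sup>2 * a x + 2 * (\<bar>R x\<bar> * \<bar>v x\<bar>) \<partial>M)"
    proof (rule integral_mono_AE)
      show "integrable M (\<lambda>x. 2 * (f x * v x))" using int_mult[OF f v] by simp
      show "integrable M (\<lambda>x. a x * v x * v x + Q\<^sup>2 * a x + 2 * (\<bar>R x\<bar> * \<bar>v x\<bar>))"
        using int_mult2[OF v v] a(1) R(2)[OF v]
        by (intro Bochner_Integration.integrable_add integrable_mult_right)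
      show "AE x in M. 2 * (f x * v x) \<le> a x * v x * v x + Q\<^sup>2 * a x + 2 * (\<bar>R x\<bar> * \<bar>v x\<bar>)"
        using f_le a(2)
      proof eventually_elim
        case (elim x)
        have "f x * v x \<le> \<bar>f x\<bar> * \<bar>v x\<bar>" by (metis abs_ge_self abs_mult)
        also have "\<dots> \<le> (Q * a x + \<bar>R x\<bar>) * \<bar>v x\<bar>" using elim(1) by (rule mult_right_mono) simp
        finally have 1: "f x * v x \<le> Q * a x * \<bar>v x\<bar> + \<bar>R x\<bar> * \<bar>v x\<bar>" by (simp add: algebra_simps)
        have "0 \<le> a x * (\<bar>v x\<bar> - Q)\<^sup>2" using elim(2) by simp
        also have "\<dots> = a x * \<bar>v x\<bar>\<^sup>2 - 2 * (Q * a x * \<bar>v x\<bar>) + Q\<^sup>2 * a x"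
          by (simp only: power2_eq_square) (simp add: algebra_simps)
        finally have "2 * (Q * a x * \<bar>v x\<bar>) \<le> a x * v x * v x + Q\<^sup>2 * a x"
          by (simp add: power2_eq_square mult.assoc)
        then show ?case using 1 by linarith
      qed
    qed
    also have "\<dots> = (\<integral>x. a x * v x * v x \<partial>M) + Q\<^sup>2 * (\<integral>x. a x \<partial>M) + 2 * (\<integral>x. \<bar>R x\<bar> * \<bar>v x\<bar> \<partial>M)"
      using int_mult2[OF v v] a(1) R(2)[OF v] by simp
    finally have 1: "2 * l v \<le> (\<integral>x. a x * v x * v x \<partial>M) + Q\<^sup>2 * (\<integral>x. a x \<partial>M) + 2 * (D * (X_norm \<Omega> X v + 1))"
      using R(3)[OF v] by linarith
    let ?N = "X_norm \<Omega> X v"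
    have "?N\<^sup>2 \<le> \<Lambda> * grad_form v v"
      using X_form_le[OF v] X_norm_power2[OF v] by simp
    then have N: "?N\<^sup>2 / \<Lambda> \<le> grad_form v v"
      using \<Lambda>_pos by (simp add: divide_le_eq mult.commute)
    \<comment> \<open>Completing the square so that the quadratic term is exactly what ellipticity provides.\<close>
    have "0 \<le> (?N - D * \<Lambda>)\<^sup>2 / \<Lambda>" using \<Lambda>_pos by simp
    also have "\<dots> = ?N\<^sup>2 / \<Lambda> - 2 * (D * ?N) + D\<^sup>2 * \<Lambda>"
      using \<Lambda>_pos by (simp add: field_simps power2_eq_square)
    finally show ?thesis using 1 N by (simp add: E_def algebra_simps)
  qed
  have ne: "C1_0 \<Omega> \<noteq> {}" using C1_0_zero by blast
  obtain \<phi> where \<phi>: "\<And>n. \<phi> n \<in> C1_0 \<Omega>"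
    and cauchy: "\<And>e. e > 0 \<Longrightarrow> \<exists>M. \<forall>m\<ge>M. \<forall>n\<ge>M. E (\<lambda>x. \<phi> m x - \<phi> n x) (\<lambda>x. \<phi> m x - \<phi> n x) < e"
    and conv: "\<And>v. v \<in> C1_0 \<Omega> \<Longrightarrow> (\<lambda>n. E (\<phi> n) v) \<longlonglongrightarrow> l v"
    using E.approximate_Riesz[OF ne l_lin l_bound] by blast
  have asq: "0 \<le> (\<integral>x. a x * (h x)\<^sup>2 \<partial>M)" for h :: "real^'n \<Rightarrow> real"
    using a(2) by (intro integral_nonneg_AE) (auto elim: eventually_mono)
  have E_eq: "E v v = grad_form v v + (\<integral>x. a x * (v x)\<^sup>2 \<partial>M)" for v
    by (simp add: E_def power2_eq_square mult.assoc)
  have \<phi>C: "\<phi> \<in> X_Cauchy \<Omega> X"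
    unfolding X_Cauchy_def
  proof (intro CollectI conjI allI impI \<phi>)
    fix e :: real assume e: "e > 0"
    then have "e\<^sup>2 / \<Lambda> > 0" using \<Lambda>_pos by simp
    from cauchy[OF this] obtain K where K:
      "\<And>m n. m \<ge> K \<Longrightarrow> n \<ge> K \<Longrightarrow> E (\<lambda>x. \<phi> m x - \<phi> n x) (\<lambda>x. \<phi> m x - \<phi> n x) < e\<^sup>2 / \<Lambda>" by blast
    have "X_norm \<Omega> X (\<lambda>x. \<phi> m x - \<phi> n x) < e" if "m \<ge> K" "n \<ge> K" for m n
    proof -
      let ?d = "\<lambda>x. \<phi> m x - \<phi> n x"
      have d: "?d \<in> C1_0 \<Omega>" by (intro C1_0_diff \<phi>)
      have "X_form ?d ?d \<le> \<Lambda> * grad_form ?d ?d" by (rule X_form_le[OF d])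
      also have "\<dots> \<le> \<Lambda> * E ?d ?d"
        unfolding E_eq using asq[of ?d] \<Lambda>_pos by (intro mult_left_mono) auto
      also have "\<dots> < \<Lambda> * (e\<^sup>2 / \<Lambda>)"
        using K[OF that] \<Lambda>_pos by (intro mult_strict_left_mono)
      finally have "X_form ?d ?d < e\<^sup>2" using \<Lambda>_pos by simp
      then show ?thesis
        unfolding X_norm_eq using e by (metis real_sqrt_less_mono real_sqrt_unique less_imp_le)
    qed
    then show "\<exists>M. \<forall>m\<ge>M. \<forall>n\<ge>M. X_norm \<Omega> X (\<lambda>x. \<phi> m x - \<phi> n x) < e" by blast
  qed
  define U where "U = HX_class \<phi>"
  have U: "U \<in> HX \<Omega> X" and \<phi>U: "\<phi> \<in> U" unfolding U_def using HX_class_in_HX mem_HX_class \<phi>C by auto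
  let ?u = "HX_fun \<Omega> U"
  have um: "?u \<in> borel_measurable M" using HX_fun_integrable[OF U] by auto
  have am: "a \<in> borel_measurable M" using a(1) by auto
  have aint: "integrable M (\<lambda>x. a x * \<phi> n x)" for n by (intro int_mult a \<phi>)
  obtain r where r: "strict_mono r" "AE x in M. (\<lambda>n. \<phi> (r n) x) \<longlonglongrightarrow> ?u x"
    using L1_limit_AE_subseq[OF integrable_C1_0[OF \<phi>] HX_fun_integrable[OF U] HX_fun_limit[OF U \<phi>U]] by blast
  have au_lim: "AE x in M. (\<lambda>n. a x * \<phi> (r n) x) \<longlonglongrightarrow> a x * ?u x"
    using r(2) by eventually_elim (intro tendsto_mult_left)
  have au_cauchy: "\<exists>K. \<forall>m\<ge>K. \<forall>n\<ge>K. (\<integral>x. \<bar>a x * \<phi> m x - a x * \<phi> n x\<bar> \<partial>M) < e" if e: "e > 0" for e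
  proof -
    define I where "I = (\<integral>x. a x \<partial>M)"
    have I: "I \<ge> 0" unfolding I_def using a(2) by (rule integral_nonneg_AE)
    define d where "d = e / (2 * (I + 1))"
    have d: "d > 0" using e I by (simp add: d_def)
    have dI: "d * I < e / 2"
      using e I by (simp add: d_def field_simps)
    have "d * (e / 2) > 0" using d e by simp
    from cauchy[OF this] obtain K where K:
      "\<And>m n. m \<ge> K \<Longrightarrow> n \<ge> K \<Longrightarrow> E (\<lambda>x. \<phi> m x - \<phi> n x) (\<lambda>x. \<phi> m x - \<phi> n x) < d * (e / 2)" by blast
    have "(\<integral>x. \<bar>a x * \<phi> m x - a x * \<phi> n x\<bar> \<partial>M) < e" if "m \<ge> K" "n \<ge> K" for m n
    proof -
      let ?h = "\<lambda>x. \<phi> m x - \<phi> n x"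
      have h: "?h \<in> C1_0 \<Omega>" by (intro C1_0_diff \<phi>)
      have i2: "integrable M (\<lambda>x. a x * (?h x)\<^sup>2)"
        using int_mult2[OF h h] by (simp add: power2_eq_square mult.assoc)
      have "(\<integral>x. a x * (?h x)\<^sup>2 \<partial>M) < d * (e / 2)"
        using K[OF that] E_eq[of ?h] G.nonneg[OF h] by linarith
      then have "(\<integral>x. a x * (?h x)\<^sup>2 \<partial>M) / d < e / 2"
        using d by (simp add: divide_less_eq mult.commute)
      moreover have "(\<integral>x. \<bar>a x * ?h x\<bar> \<partial>M) \<le> d * I + (\<integral>x. a x * (?h x)\<^sup>2 \<partial>M) / d"
        unfolding I_def by (rule weighted_L1_le[OF a int_mult[OF a(1) h] i2 d])
      ultimately show ?thesis using dI unfolding right_diff_distrib by linarith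
    qed
    then show ?thesis by blast
  qed
  have au: "integrable M (\<lambda>x. a x * ?u x)"
    and au_conv: "(\<lambda>n. \<integral>x. \<bar>a x * \<phi> n x - a x * ?u x\<bar> \<partial>M) \<longlonglongrightarrow> 0"
    using L1_Cauchy_AE_limit[where h = "\<lambda>n x. a x * \<phi> n x" and g = "\<lambda>x. a x * ?u x",
        OF aint borel_measurable_times[OF am um] r(1) au_lim au_cauchy] by auto
  have eq_C1: "(\<lambda>n. grad_form (\<phi> n) v) \<longlonglongrightarrow> l v - (\<integral>x. a x * ?u x * v x \<partial>M)" if v: "v \<in> C1_0 \<Omega>" for v
  proof -
    obtain C where C: "C \<ge> 0" "\<And>x. \<bar>v x\<bar> \<le> C" using C1_0_bounded[OF v] by blast
    have bound: "norm ((\<integral>x. a x * \<phi> n x * v x \<partial>M) - (\<integral>x. a x * ?u x * v x \<partial>M))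
        \<le> (\<integral>x. \<bar>a x * \<phi> n x - a x * ?u x\<bar> \<partial>M) * C" for n
    proof -
      have i: "integrable M (\<lambda>x. a x * \<phi> n x - a x * ?u x)" by (intro Bochner_Integration.integrable_diff aint au)
      have "(\<integral>x. a x * \<phi> n x * v x \<partial>M) - (\<integral>x. a x * ?u x * v x \<partial>M)
          = (\<integral>x. (a x * \<phi> n x - a x * ?u x) * v x \<partial>M)"
        using int_mult[OF aint v, of n] int_mult[OF au v] by (simp add: left_diff_distrib)
      also have "norm \<dots> \<le> (\<integral>x. norm ((a x * \<phi> n x - a x * ?u x) * v x) \<partial>M)"
        by (rule integral_norm_bound)
      also have "\<dots> \<le> (\<integral>x. \<bar>a x * \<phi> n x - a x * ?u x\<bar> * C \<partial>M)"
        by (intro integral_mono integrable_norm int_mult[OF i v] integrable_mult_left integrable_abs i)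
          (simp add: abs_mult mult_left_mono C)
      finally show ?thesis by simp
    qed
    have "(\<lambda>n. (\<integral>x. a x * \<phi> n x * v x \<partial>M) - (\<integral>x. a x * ?u x * v x \<partial>M)) \<longlonglongrightarrow> 0"
      by (rule Lim_null_comparison[OF always_eventually[OF allI[OF bound]]])
        (rule tendsto_mult_left_zero[OF au_conv])
    then have "(\<lambda>n. \<integral>x. a x * \<phi> n x * v x \<partial>M) \<longlonglongrightarrow> (\<integral>x. a x * ?u x * v x \<partial>M)"
      by (simp add: LIM_zero_iff)
    from tendsto_diff[OF conv[OF v] this] show ?thesis by (simp add: E_def)
  qed
  have "HX_form \<Omega> B U V + (\<integral>x. a x * ?u x * HX_fun \<Omega> V x \<partial>M) = (\<integral>x. f x * HX_fun \<Omega> V x \<partial>M)"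
    if V: "V \<in> HX \<Omega> X" and b: "HX_fun \<Omega> V \<in> Linf_space M" for V
  proof -
    let ?v = "HX_fun \<Omega> V"
    obtain \<psi> K where \<psi>: "\<psi> \<in> V" and K: "\<And>n x. \<bar>\<psi> n x\<bar> \<le> K" using bounded_test_sequence[OF V b] by blast
    note \<psi>C = HX_memD[OF V \<psi>]
    note C1 = X_Cauchy_C1_0[OF \<psi>C]
    define c where "c i = l (\<psi> i) - (\<integral>x. a x * ?u x * \<psi> i x \<partial>M)" for i
    \<comment> \<open>\<open>c i\<close> is the limit in \<open>n\<close> of \<open>grad_form (\<phi> n) (\<psi> i)\<close>, whereas \<open>HX_form\<close> is a limit
      along the diagonal. The two agree because \<open>\<psi>\<close> is Cauchy and \<open>\<phi>\<close> is bounded.\<close>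
    have c_lim: "c \<longlonglongrightarrow> HX_form \<Omega> B U V"
    proof (rule LIMSEQ_I)
      fix e :: real assume e: "e > 0"
      obtain F where F: "F > 0" "\<And>n. X_norm \<Omega> X (\<phi> n) \<le> F" using X_Cauchy_bounded[OF \<phi>C] by blast
      have "e / (2 * \<Lambda> * F) > 0" using e F \<Lambda>_pos by simp
      then obtain L where L: "\<And>m n. m \<ge> L \<Longrightarrow> n \<ge> L \<Longrightarrow> X_norm \<Omega> X (\<lambda>x. \<psi> m x - \<psi> n x) < e / (2 * \<Lambda> * F)"
        using X_CauchyD[OF \<psi>C] by blast
      have "\<bar>c i - HX_form \<Omega> B U V\<bar> \<le> e / 2" if i: "i \<ge> L" for i
      proof (rule LIMSEQ_le_const2)
        show "(\<lambda>n. \<bar>grad_form (\<phi> n) (\<psi> i) - grad_form (\<phi> n) (\<psi> n)\<bar>) \<longlonglongrightarrow> \<bar>c i - HX_form \<Omega> B U V\<bar>"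
          unfolding c_def by (intro tendsto_rabs tendsto_diff eq_C1 C1 grad_form_tendsto_HX_form U V \<phi>U \<psi>)
        have "\<bar>grad_form (\<phi> n) (\<psi> i) - grad_form (\<phi> n) (\<psi> n)\<bar> \<le> e / 2" if n: "n \<ge> L" for n
        proof -
          have d: "(\<lambda>x. \<psi> i x - \<psi> n x) \<in> C1_0 \<Omega>" by (intro C1_0_diff C1)
          have "\<bar>grad_form (\<phi> n) (\<psi> i) - grad_form (\<phi> n) (\<psi> n)\<bar> = \<bar>grad_form (\<phi> n) (\<lambda>x. \<psi> i x - \<psi> n x)\<bar>"
            by (simp add: G.diff_right C1 \<phi>)
          also have "\<dots> \<le> \<Lambda> * X_norm \<Omega> X (\<phi> n) * X_norm \<Omega> X (\<lambda>x. \<psi> i x - \<psi> n x)"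
            by (rule abs_grad_form_le[OF \<phi> d])
          also have "\<dots> \<le> \<Lambda> * F * (e / (2 * \<Lambda> * F))"
            using L[OF i n] F \<Lambda>_pos X_norm_nonneg[OF \<phi>] X_norm_nonneg[OF d]
            by (intro mult_mono) auto
          also have "\<dots> = e / 2" using F(1) \<Lambda>_pos by simp
          finally show ?thesis .
        qed
        then show "\<exists>N. \<forall>n\<ge>N. \<bar>grad_form (\<phi> n) (\<psi> i) - grad_form (\<phi> n) (\<psi> n)\<bar> \<le> e / 2" by blast
      qed
      then show "\<exists>no. \<forall>n\<ge>no. norm (c n - HX_form \<Omega> B U V) < e" using e by (intro exI[of _ L]) force
    qed
    obtain s where s: "strict_mono s" "AE x in M. (\<lambda>n. \<psi> (s n) x) \<longlonglongrightarrow> ?v x"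
      using L1_limit_AE_subseq[OF integrable_C1_0[OF C1] HX_fun_integrable[OF V] HX_fun_limit[OF V \<psi>]] by blast
    have dct: "(\<lambda>i. \<integral>x. g x * \<psi> (s i) x \<partial>M) \<longlonglongrightarrow> (\<integral>x. g x * ?v x \<partial>M)" if g: "integrable M g" for g
    proof (rule integral_dominated_convergence[where w = "\<lambda>x. \<bar>g x\<bar> * K"])
      have gm: "g \<in> borel_measurable M" using g by auto
      show "(\<lambda>x. g x * ?v x) \<in> borel_measurable M"
        using gm HX_fun_integrable[OF V] by (intro borel_measurable_times) auto
      show "(\<lambda>x. g x * \<psi> (s i) x) \<in> borel_measurable M" for i
        by (intro borel_measurable_times gm measurable_C1_0 C1)
      show "integrable M (\<lambda>x. \<bar>g x\<bar> * K)" using g by auto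
      show "AE x in M. (\<lambda>i. g x * \<psi> (s i) x) \<longlonglongrightarrow> g x * ?v x"
        using s(2) by eventually_elim (intro tendsto_mult_left)
      show "AE x in M. norm (g x * \<psi> (s i) x) \<le> \<bar>g x\<bar> * K" for i
        by (intro AE_I2) (simp add: abs_mult mult_left_mono K)
    qed
    have "(\<lambda>i. c (s i)) \<longlonglongrightarrow> (\<integral>x. f x * ?v x \<partial>M) - (\<integral>x. a x * ?u x * ?v x \<partial>M)"
      unfolding c_def l_def by (intro tendsto_diff dct f au)
    moreover have "(\<lambda>i. c (s i)) \<longlonglongrightarrow> HX_form \<Omega> B U V"
      using LIMSEQ_subseq_LIMSEQ[OF c_lim s(1)] by (simp add: o_def)
    ultimately show ?thesis using LIMSEQ_unique by fastforce
  qed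
  then have "weak_solution \<Omega> X B a f U" using U au by (simp add: weak_solution_def)
  then show thesis by (rule that)
qed

end

section \<open>Unique solvability\<close>

theorem theorem4p1:
  fixes \<Omega> :: "(real^'n::finite) set"
    and X :: "'m::finite \<Rightarrow> real^'n \<Rightarrow> real^'n"
    and B :: "real^'n \<Rightarrow> real^'n^'n"
    and a f R :: "real^'n \<Rightarrow> real"
    and q Q :: real
  assumes "CARD('n) \<ge> 2"
    and "open \<Omega>" and "connected \<Omega>" and "bounded \<Omega>" and "\<Omega> \<noteq> {}"
    and "locally_lipschitz_fields X"
    and "\<And>i j. (\<lambda>x. B x $ i $ j) \<in> borel_measurable lebesgue"
    and "\<And>i j x. B x $ i $ j = B x $ j $ i"
    and "uniformly_X_elliptic \<Omega> X B"
    and "assumption_S \<Omega> X q"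
    and "integrable (lebesgue_on \<Omega>) a"
    and "AE x in lebesgue_on \<Omega>. a x \<ge> 0"
    and "integrable (lebesgue_on \<Omega>) f"
    and "Q > 0"
    and "AE x in lebesgue_on \<Omega>. R x \<ge> 0"
    and "R \<in> Lp_space (lebesgue_on \<Omega>) (2 * N_X q / (N_X q + 2))"
    and "AE x in lebesgue_on \<Omega>. \<bar>f x\<bar> \<le> Q * a x + R x"
  shows "\<exists>!U. weak_solution \<Omega> X B a f U"
proof -
  obtain \<Lambda> where \<Lambda>: "\<Lambda> > 0"
    and ell: "\<And>x \<xi>. x \<in> \<Omega> \<Longrightarrow> (1 / \<Lambda>) * (\<Sum>j\<in>UNIV. (X j x \<bullet> \<xi>)\<^sup>2) \<le> (B x *v \<xi>) \<bullet> \<xi>"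
      "\<And>x \<xi>. x \<in> \<Omega> \<Longrightarrow> (B x *v \<xi>) \<bullet> \<xi> \<le> \<Lambda> * (\<Sum>j\<in>UNIV. (X j x \<bullet> \<xi>)\<^sup>2)"
    using assms(9) unfolding uniformly_X_elliptic_def quadratic_form_eq_inner by blast
  have q: "q > 2" and emb: "HX_embeds \<Omega> X 1" "HX_embeds \<Omega> X q"
    using assms(10) by (auto simp: assumption_S_def)
  interpret X_elliptic_embedded \<Omega> X B \<Lambda>
  proof
    show "(\<Sum>j\<in>UNIV. (X j x \<bullet> \<xi>)\<^sup>2) \<le> \<Lambda> * ((B x *v \<xi>) \<bullet> \<xi>)" if "x \<in> \<Omega>" for x \<xi>
      using ell(1)[OF that, of \<xi>] \<Lambda> by (simp add: divide_le_eq mult.commute)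
    show "continuous_on UNIV (X j)" for j
      by (rule continuous_of_locally_lipschitz_fields) fact
  qed (fact assms \<Lambda> ell(2) emb(1))+
  define p where "p = 2 * N_X q / (N_X q + 2)"
  \<comment> \<open>The exponent required of \<open>R\<close> is the Hoelder conjugate of \<open>q\<close>.\<close>
  have p_eq: "p = q / (q - 1)"
    unfolding p_def N_X_def using q by (simp add: divide_simps)
  have p: "p > 1" "1 / p + 1 / q = 1"
    unfolding p_eq using q by (auto simp: field_simps)
  have R: "R \<in> Lp_space M p" using assms(16) by (simp add: p_def)
  have f_le: "AE x in M. \<bar>f x\<bar> \<le> Q * a x + \<bar>R x\<bar>"
    using assms(15,17) by eventually_elim simp
  have q1: "q > 1" using q by simp
  obtain D where D: "D \<ge> 0" "\<And>\<phi>. \<phi> \<in> C1_0 \<Omega> \<Longrightarrow> integrable M (\<lambda>x. \<bar>R x\<bar> * \<bar>\<phi> x\<bar>)"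
    "\<And>\<phi>. \<phi> \<in> C1_0 \<Omega> \<Longrightarrow> (\<integral>x. \<bar>R x\<bar> * \<bar>\<phi> x\<bar> \<partial>M) \<le> D * (X_norm \<Omega> X \<phi> + 1)"
    using dual_exponent_pairing_bound[OF emb(2) q1 p(2) p(1) R] by blast
  obtain U where "weak_solution \<Omega> X B a f U"
    using weak_solution_exists[OF assms(11-13) D f_le] by blast
  then show ?thesis
    using weak_solution_unique[OF assms(11,12)] by blast
qed

end
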